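(* Let $G$ be a countable left-cancellative semigroup with unit $e$, and let $(Y_0,\nu_0)$ be a non-atomic standard probability space. Set $(Y,\nu)=(Y_0,\nu_0)^G$. Then there is a subgroup $\Lambda\subset\operatorname{Aut}_\nu(Y)$ such that $$\operatorname{Factor}(\Lambda\curvearrowright(Y,\nu))=G^{\mathrm{op}},$$ where $G^{\mathrm{op}}$ is identified with the set of measure preserving quotient maps $f_g:Y\to Y$, $g\in G$, given by $f_g(x)_h=x_{gh}$ for $h\in G$ (so that $f_gf_h=f_{hg}$).
   Context: $\operatorname{Aut}_\nu(Y)$ is the group of measure preserving automorphisms of $(Y,\nu)$ (modulo null sets). $\operatorname{Factor}(\Lambda\curvearrowright(Y,\nu))$ is the semigroup, under composition, of all measure preserving maps $\Delta:Y\to Y$ (modulo null sets) such that for every $\lambda\in\Lambda$, $\Delta(\lambda y)=\lambda\Delta(y)$ for almost all $y$. $G$ left-cancellative means $gh=gk$ implies $h=k$. $G^{\mathrm{op}}$ is the opposite semigroup of $G$. *)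

theory Defs
  imports "HOL-Probability.Probability" "HOL-Algebra.Group"
begin

definition standard_borel :: "'a measure \<Rightarrow> bool" where
  "standard_borel M \<longleftrightarrow>
     (\<exists>X. topspace X = space M \<and> completely_metrizable_space X \<and> second_countable X \<and>
          sets M = sigma_sets (topspace X) {U. openin X U})"

definition standard_prob_space :: "'a measure \<Rightarrow> bool" where
  "standard_prob_space M \<longleftrightarrow> prob_space M \<and> standard_borel M"

definition non_atomic :: "'a measure \<Rightarrow> bool" where
  "non_atomic M \<longleftrightarrow>
     (\<forall>A\<in>sets M. emeasure M A > 0 \<longrightarrow>
        (\<exists>B\<in>sets M. B \<subseteq> A \<and> 0 < emeasure M B \<and> emeasure M B < emeasure M A))"

definition mp_maps :: "'a measure \<Rightarrow> ('a \<Rightarrow> 'a) set" where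
  "mp_maps N = {T \<in> N \<rightarrow>\<^sub>M N. distr N N T = N}"

(* Maps modulo null sets are represented by their almost-everywhere-equality classes.
   Values of a map outside space N are irrelevant to its class. *)
definition mp_class :: "'a measure \<Rightarrow> ('a \<Rightarrow> 'a) \<Rightarrow> ('a \<Rightarrow> 'a) set" where
  "mp_class N T = {S \<in> mp_maps N. AE x in N. S x = T x}"

(* The product of two classes is the class of the composition of representatives; ranging over
   all representatives avoids a choice (see mp_monoid_mult_class below). *)
definition mp_monoid :: "'a measure \<Rightarrow> ('a \<Rightarrow> 'a) set monoid" where
  "mp_monoid N =
     \<lparr>carrier = mp_class N ` mp_maps N,
      mult = (\<lambda>A B. {S \<in> mp_maps N. \<exists>a\<in>A. \<exists>b\<in>B. AE x in N. S x = a (b x)}),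
      one = mp_class N (\<lambda>x. x)\<rparr>"

(* Automorphisms modulo null sets: measure preserving maps having a measure preserving
   inverse up to null sets, i.e. the invertible elements of mp_monoid N. *)
definition Aut_mp :: "'a measure \<Rightarrow> ('a \<Rightarrow> 'a) set monoid" where
  "Aut_mp N = units_of (mp_monoid N)"

definition Factor :: "('a \<Rightarrow> 'a) set set \<Rightarrow> 'a measure \<Rightarrow> ('a \<Rightarrow> 'a) set monoid" where
  "Factor \<Lambda> N = (mp_monoid N)
     \<lparr>carrier := {D \<in> carrier (mp_monoid N).
        \<forall>L\<in>\<Lambda>. \<forall>\<Delta>\<in>D. \<forall>l\<in>L. AE y in N. \<Delta> (l y) = l (\<Delta> y)}\<rparr>"

definition left_cancellative :: "('g, 'b) monoid_scheme \<Rightarrow> bool" where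
  "left_cancellative G \<longleftrightarrow>
     (\<forall>g\<in>carrier G. \<forall>h\<in>carrier G. \<forall>k\<in>carrier G. g \<otimes>\<^bsub>G\<^esub> h = g \<otimes>\<^bsub>G\<^esub> k \<longrightarrow> h = k)"

definition opposite :: "('g, 'b) monoid_scheme \<Rightarrow> 'g monoid" where
  "opposite G = \<lparr>carrier = carrier G, mult = (\<lambda>g h. h \<otimes>\<^bsub>G\<^esub> g), one = \<one>\<^bsub>G\<^esub>\<rparr>"

definition shift_map :: "('g, 'b) monoid_scheme \<Rightarrow> 'g \<Rightarrow> ('g \<Rightarrow> 'a) \<Rightarrow> 'g \<Rightarrow> 'a" where
  "shift_map G g x = (\<lambda>h\<in>carrier G. x (g \<otimes>\<^bsub>G\<^esub> h))"

lemma mp_maps_comp: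
  assumes "S \<in> mp_maps N" "T \<in> mp_maps N"
  shows "(\<lambda>x. S (T x)) \<in> mp_maps N"
proof -
  have m: "S \<in> N \<rightarrow>\<^sub>M N" "T \<in> N \<rightarrow>\<^sub>M N" "distr N N S = N" "distr N N T = N"
    using assms by (auto simp: mp_maps_def)
  have "distr N N (\<lambda>x. S (T x)) = N"
    using distr_distr[OF m(1,2)] m(3,4) by (simp add: comp_def)
  then show ?thesis using m by (simp add: mp_maps_def)
qed

lemma AE_mp_maps:
  assumes "T \<in> mp_maps N" "AE x in N. P x"
  shows "AE x in N. P (T x)"
proof -
  have m: "T \<in> N \<rightarrow>\<^sub>M N" "distr N N T = N" using assms by (auto simp: mp_maps_def)
  have "AE x in distr N N T. P x" unfolding m(2) by (rule assms(2))
  then show ?thesis using AE_distrD[OF m(1)] by blast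
qed

lemma mp_monoid_mult_class:
  assumes "S \<in> mp_maps N" "T \<in> mp_maps N"
  shows "mp_class N S \<otimes>\<^bsub>mp_monoid N\<^esub> mp_class N T = mp_class N (\<lambda>x. S (T x))"
proof (intro equalityI subsetI)
  fix R assume "R \<in> mp_class N S \<otimes>\<^bsub>mp_monoid N\<^esub> mp_class N T"
  then obtain a b where R: "R \<in> mp_maps N" "AE x in N. R x = a (b x)"
    and a: "AE x in N. a x = S x" and b: "b \<in> mp_maps N" "AE x in N. b x = T x"
    by (auto simp: mp_monoid_def mp_class_def)
  have "AE x in N. a (b x) = S (b x)" using AE_mp_maps[OF b(1) a] .
  with R(2) b(2) have "AE x in N. R x = S (T x)" by eventually_elim simp
  with R(1) show "R \<in> mp_class N (\<lambda>x. S (T x))" by (simp add: mp_class_def)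
next
  fix R assume "R \<in> mp_class N (\<lambda>x. S (T x))"
  then show "R \<in> mp_class N S \<otimes>\<^bsub>mp_monoid N\<^esub> mp_class N T"
    using assms by (auto simp: mp_monoid_def mp_class_def intro!: bexI[of _ S] bexI[of _ T])
qed

lemma mp_id: "(\<lambda>x. x) \<in> mp_maps N"
  by (simp add: mp_maps_def distr_id2)

lemma monoid_mp_monoid: "Group.monoid (mp_monoid N)"
proof
  fix A B assume "A \<in> carrier (mp_monoid N)" "B \<in> carrier (mp_monoid N)"
  then show "A \<otimes>\<^bsub>mp_monoid N\<^esub> B \<in> carrier (mp_monoid N)"
    by (auto simp: mp_monoid_def mp_monoid_mult_class[unfolded mp_monoid_def, simplified] mp_maps_comp)
next
  fix A B C assume "A \<in> carrier (mp_monoid N)" "B \<in> carrier (mp_monoid N)" "C \<in> carrier (mp_monoid N)"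
  then obtain a b c where "a \<in> mp_maps N" "b \<in> mp_maps N" "c \<in> mp_maps N"
    "A = mp_class N a" "B = mp_class N b" "C = mp_class N c"
    by (auto simp: mp_monoid_def)
  then show "A \<otimes>\<^bsub>mp_monoid N\<^esub> B \<otimes>\<^bsub>mp_monoid N\<^esub> C = A \<otimes>\<^bsub>mp_monoid N\<^esub> (B \<otimes>\<^bsub>mp_monoid N\<^esub> C)"
    by (simp add: mp_monoid_mult_class mp_maps_comp)
next
  show "\<one>\<^bsub>mp_monoid N\<^esub> \<in> carrier (mp_monoid N)" by (simp add: mp_monoid_def mp_id)
next
  have one: "\<one>\<^bsub>mp_monoid N\<^esub> = mp_class N (\<lambda>x. x)" by (simp add: mp_monoid_def)
  fix A assume "A \<in> carrier (mp_monoid N)"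
  then obtain a where "a \<in> mp_maps N" "A = mp_class N a" by (auto simp: mp_monoid_def)
  then show "\<one>\<^bsub>mp_monoid N\<^esub> \<otimes>\<^bsub>mp_monoid N\<^esub> A = A" "A \<otimes>\<^bsub>mp_monoid N\<^esub> \<one>\<^bsub>mp_monoid N\<^esub> = A"
    by (simp_all add: one mp_monoid_mult_class mp_id)
qed

lemma group_Aut_mp: "group (Aut_mp N)"
  unfolding Aut_mp_def by (rule monoid.units_group[OF monoid_mp_monoid])

end

theory Submission
  imports Defs
begin

text \<open>Take \<open>\<Lambda>\<close> to be the group of all automorphisms commuting with every \<open>f\<^sub>g\<close>. A non-atomic
  standard probability space is isomorphic modulo null sets to a sequence of fair coin tosses, so \<open>Y\<close>
  becomes a space of bits indexed by \<open>G \<times> \<nat>\<close>. There \<open>\<Lambda>\<close> contains the maps that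
  flip the bits \<open>(g, n)\<close>, with \<open>n\<close> fixed and \<open>g\<close> varying, according to a shift-invariant rule on the
  other bits, and the maps that permute the second index.

  Let \<open>\<Delta>\<close> commute with \<open>\<Lambda>\<close> and fix \<open>h\<close>. One bit of \<open>\<Delta> z\<close> at \<open>h\<close> is approximated by a function of
  finitely many coordinates of \<open>z\<close>. If \<open>\<Delta> z\<close> at \<open>h\<close> agreed with none of these coordinates, then flipping
  that bit wherever the other bits match a suitable pattern would change \<open>\<Delta> z\<close> at \<open>h\<close> but not the
  approximation. So \<open>\<Delta> z\<close> at \<open>h\<close> equals some coordinate of \<open>z\<close>. By ergodicity of the permutations this
  coordinate is a constant \<open>\<gamma> h\<close>, and flipping the bits \<open>(g, 0)\<close> for which the bit \<open>(g k, 1)\<close> is set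
  gives \<open>\<gamma> k = (\<gamma> e) k\<close>, so \<open>\<Delta>\<close> is the shift by \<open>\<gamma> e\<close>.\<close>

section \<open>Isomorphism modulo null sets with coin tosses\<close>

text \<open>The inverse is carried along as a total measurable map, so that both directions and
  compositions can be used without asking whether images of measurable sets are measurable.\<close>

definition mp_iso :: "'a measure \<Rightarrow> 'b measure \<Rightarrow> ('a \<Rightarrow> 'b) \<Rightarrow> ('b \<Rightarrow> 'a) \<Rightarrow> bool" where
  "mp_iso M N f g \<longleftrightarrow> f \<in> M \<rightarrow>\<^sub>M N \<and> g \<in> N \<rightarrow>\<^sub>M M \<and> distr M N f = N \<and> distr N M g = M \<and>
     (AE x in M. g (f x) = x) \<and> (AE y in N. f (g y) = y)"

lemma AE_distr_eq:
  assumes "f \<in> M \<rightarrow>\<^sub>M N" "distr M N f = N" "AE y in N. P y"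
  shows "AE x in M. P (f x)"
  using AE_distrD[OF assms(1), of P] unfolding assms(2) using assms(3) by simp

text \<open>\<open>g\<close> pushes the law of \<open>f\<close> to the law of
  \<open>g (f x)\<close>, which is that of \<open>x\<close>. The identity \<open>f (g y) = y\<close>
  holds on the image of \<open>f\<close>, and \<open>meas\<close> allows it to be read as an event
  of full measure under \<open>distr M N f\<close>.\<close>

lemma mp_isoI:
  assumes f: "f \<in> M \<rightarrow>\<^sub>M N" and g: "g \<in> N \<rightarrow>\<^sub>M M" and d: "distr M N f = N"
    and gf: "AE x in M. g (f x) = x" and meas: "{y \<in> space N. f (g y) = y} \<in> sets N"
  shows "mp_iso M N f g"
proof -
  have "distr N M g = distr (distr M N f) M g" by (simp only: d)
  also have "\<dots> = distr M M (\<lambda>x. g (f x))" using f g by (simp add: distr_distr comp_def)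
  also have "\<dots> = distr M M (\<lambda>x. x)"
    using gf f g by (intro distr_cong_AE) auto
  finally have 1: "distr N M g = M" by (simp add: distr_id2)
  have "AE x in M. f (g (f x)) = f x" using gf by eventually_elim simp
  then have "AE y in distr M N f. f (g y) = y"
    using meas by (subst AE_distr_iff[OF f]) auto
  with 1 assms show ?thesis unfolding mp_iso_def d by simp
qed

lemma mp_iso_sym: "mp_iso M N f g \<Longrightarrow> mp_iso N M g f"
  by (auto simp: mp_iso_def)

lemma mp_iso_trans:
  assumes "mp_iso M N f g" "mp_iso N K f' g'"
  shows "mp_iso M K (\<lambda>x. f' (f x)) (\<lambda>z. g (g' z))"
proof -
  have m: "f \<in> M \<rightarrow>\<^sub>M N" "g \<in> N \<rightarrow>\<^sub>M M" "distr M N f = N" "distr N M g = M"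
    "AE x in M. g (f x) = x" "AE y in N. f (g y) = y"
    "f' \<in> N \<rightarrow>\<^sub>M K" "g' \<in> K \<rightarrow>\<^sub>M N" "distr N K f' = K" "distr K N g' = N"
    "AE x in N. g' (f' x) = x" "AE y in K. f' (g' y) = y"
    using assms by (auto simp: mp_iso_def)
  have "distr M K (\<lambda>x. f' (f x)) = distr (distr M N f) K f'"
    using m(1,7) by (simp add: distr_distr comp_def)
  moreover have "distr K M (\<lambda>z. g (g' z)) = distr (distr K N g') M g"
    using m(2,8) by (simp add: distr_distr comp_def)
  moreover have "AE x in M. g (g' (f' (f x))) = x"
    using m(5) AE_distr_eq[OF m(1,3,11)] by eventually_elim simp
  moreover have "AE x in K. f' (f (g (g' x))) = x"
    using m(12) AE_distr_eq[OF m(8,10,6)] by eventually_elim simp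
  ultimately show ?thesis using m by (simp add: mp_iso_def)
qed

section \<open>Bit sequences coded by points of the Cantor set\<close>

primrec cantor_rem :: "nat \<Rightarrow> real \<Rightarrow> real" where
  "cantor_rem 0 t = t"
| "cantor_rem (Suc n) t = cantor_rem n (3 * t - (if t > 1/2 then 2 else 0))"

definition cantor_digit :: "nat \<Rightarrow> real \<Rightarrow> bool" where
  "cantor_digit n t \<longleftrightarrow> cantor_rem n t > 1/2"

text \<open>Ternary digits 0 and 2 make the expansion unique, unlike binary ones. Reading digits
  with the threshold 1/2, inside the removed middle third, is meaningful on the Cantor set and still
  defined and measurable at every other real.\<close>

definition cantor :: "(nat \<Rightarrow> bool) \<Rightarrow> real" where
  "cantor b = (\<Sum>i. of_bool (b i) * (2/3) * (1/3) ^ i)"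

lemma summable_cantor: "summable (\<lambda>i. of_bool (b i) * (2/3) * (1/3::real) ^ i)"
  by (rule summable_comparison_test'[of "\<lambda>i. (1/3::real)^i" 0]) (auto simp: of_bool_def)

lemma cantor_bounds: "0 \<le> cantor b" "cantor b \<le> 1"
proof -
  show "0 \<le> cantor b" unfolding cantor_def by (intro suminf_nonneg summable_cantor) auto
  have "cantor b \<le> (\<Sum>i. (2/3) * (1/3) ^ i)"
    unfolding cantor_def
    by (intro suminf_le summable_cantor summable_mult) (auto simp: of_bool_def)
  also have "\<dots> = 1" by (subst suminf_mult) (auto simp: suminf_geometric)
  finally show "cantor b \<le> 1" .
qed

lemma cantor_step: "3 * cantor b = (if b 0 then 2 else 0) + cantor (\<lambda>i. b (Suc i))"
proof -
  have "cantor b = (\<Sum>i. of_bool (b (Suc i)) * (2/3) * (1/3) ^ (Suc i)) + of_bool (b 0) * (2/3)"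
    unfolding cantor_def by (subst suminf_split_head[OF summable_cantor]) simp
  also have "(\<Sum>i. of_bool (b (Suc i)) * (2/3) * (1/3::real) ^ (Suc i))
      = (\<Sum>i. (1/3) * (of_bool (b (Suc i)) * (2/3) * (1/3) ^ i))"
    by (intro suminf_cong) simp
  also have "\<dots> = (1/3) * cantor (\<lambda>i. b (Suc i))"
    unfolding cantor_def by (intro suminf_mult summable_cantor)
  finally show ?thesis by simp
qed

text \<open>Since the tail contributes a number in [0, 1], \<open>cantor b\<close> is at most 1/3 or
  at least 2/3 according to the first bit. Each step of \<open>cantor_rem\<close> then removes that
  bit and leaves the code of the tail.\<close>

lemma cantor_digit_cantor: "cantor_digit n (cantor b) = b n"
proof -
  have half: "cantor b > 1/2 \<longleftrightarrow> b 0" for b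
    using cantor_step[of b] cantor_bounds(1)[of "\<lambda>i. b (Suc i)"]
      cantor_bounds(2)[of "\<lambda>i. b (Suc i)"] by (simp split: if_splits; linarith)
  have "cantor_rem n (cantor b) = cantor (\<lambda>i. b (n + i))" for b
  proof (induction n arbitrary: b)
    case (Suc n)
    have "3 * cantor b - (if cantor b > 1/2 then 2 else 0) = cantor (\<lambda>i. b (Suc i))"
      unfolding half using cantor_step[of b] by simp
    with Suc[of "\<lambda>i. b (Suc i)"] show ?case by simp
  qed simp
  then show ?thesis by (simp only: cantor_digit_def half add_0_right)
qed

lemma measurable_cantor_digit [measurable]: "Measurable.pred borel (cantor_digit n)"
proof -
  have "cantor_rem n \<in> borel_measurable borel"
  proof (induction n)
    case 0 then show ?case by (simp add: cantor_rem.simps[abs_def])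
  next
    case (Suc n)
    note [measurable] = Suc
    show ?case unfolding cantor_rem.simps by measurable
  qed
  then show ?thesis unfolding cantor_digit_def by measurable
qed

text \<open>The number \<open>e x\<close> encodes, for each \<open>n\<close>, the first point of a dense sequence that is
  \<open>1 / Suc n\<close>-close to \<open>x\<close>, and \<open>d\<close> takes the limit of the encoded points. Completeness makes \<open>d\<close>
  total, so no measurability of the range of \<open>e\<close> (Lusin-Souslin) is needed.\<close>

lemma standard_borel_embedding:
  fixes M :: "'a measure"
  assumes "standard_borel M" "space M \<noteq> {}"
  obtains e :: "'a \<Rightarrow> real" and d where "e \<in> borel_measurable M" "d \<in> borel \<rightarrow>\<^sub>M M"
    "\<And>x. x \<in> space M \<Longrightarrow> d (e x) = x"
proof -
  obtain X where X: "topspace X = space M" "completely_metrizable_space X" "second_countable X"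
    and sets: "sets M = sigma_sets (topspace X) {U. openin X U}"
    using assms(1) by (auto simp: standard_borel_def)
  obtain S r where "Metric_space S r" and mc: "Metric_space.mcomplete S r"
    and Xeq: "X = Metric_space.mtopology S r"
    using X(2) by (auto simp: completely_metrizable_space_def)
  interpret Metric_space S r by fact
  have S: "S = space M" using X(1) Xeq by simp
  obtain D where D: "countable D" "D \<subseteq> S" "mtopology closure_of D = S"
    using second_countable_imp_separable_space[OF X(3)] unfolding separable_space_def Xeq by auto
  have "D \<noteq> {}" using D(3) S assms(2) by auto
  define a where "a = from_nat_into D"
  have aS: "a k \<in> S" for k using from_nat_into[OF \<open>D \<noteq> {}\<close>, of k] D(2) by (auto simp: a_def)
  have dense: "\<exists>k. r x (a k) < \<epsilon>" if x: "x \<in> S" and "\<epsilon> > 0" for x \<epsilon>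
  proof -
    have "x \<in> mtopology closure_of D" using D x by simp
    then obtain y where "y \<in> D" "y \<in> mball x \<epsilon>" using \<open>\<epsilon> > 0\<close> unfolding metric_closure_of by blast
    moreover have "y \<in> range a" using range_from_nat_into[OF \<open>D \<noteq> {}\<close> D(1)] \<open>y \<in> D\<close> by (simp add: a_def)
    ultimately show ?thesis by auto
  qed
  have open_sets: "U \<in> sets M" if "openin mtopology U" for U
    using that sets unfolding Xeq by auto

  define K where "K n x = (LEAST k. r x (a k) < 1 / Suc n)" for n x
  have K: "r x (a (K n x)) < 1 / Suc n" if "x \<in> S" for n x
    unfolding K_def by (rule LeastI_ex, rule dense[OF that]) simp
  have K_meas [measurable]: "K n \<in> M \<rightarrow>\<^sub>M count_space UNIV" for n
  proof -
    have "{x \<in> space M. r x (a k) < 1 / Suc n} \<in> sets M" for k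
    proof -
      have "{x \<in> space M. r x (a k) < 1 / Suc n} = mball (a k) (1 / Suc n)"
        using aS by (auto simp: S[symmetric] commute)
      then show ?thesis using open_sets[of "mball (a k) (1 / Suc n)"] by simp
    qed
    then have [measurable]: "Measurable.pred M (\<lambda>x. r x (a k) < 1 / Suc n)" for k by simp
    show ?thesis unfolding K_def by measurable
  qed
  \<comment> \<open>The bit numbered \<open>prod_encode (n, k)\<close> is set exactly if
    \<open>K n x = k\<close>, so the graph of the sequence of indices is stored in one real.\<close>
  define e where "e x = cantor (\<lambda>m. K (fst (prod_decode m)) x = snd (prod_decode m))" for x
  have e_meas: "e \<in> borel_measurable M" unfolding e_def cantor_def by measurable

  define L where "L n t = (LEAST k. cantor_digit (prod_encode (n, k)) t)" for n t
  have L_meas [measurable]: "L n \<in> borel \<rightarrow>\<^sub>M count_space UNIV" for n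
    unfolding L_def by measurable
  have L_e: "L n (e x) = K n x" for n x
    by (simp add: L_def e_def cantor_digit_cantor Least_equality)
  define s where "s t = (\<lambda>n. a (L n t))" for t
  have sS: "range (s t) \<subseteq> S" for t using aS by (auto simp: s_def)
  define conv where "conv t \<longleftrightarrow> (\<exists>l. limitin mtopology (s t) l sequentially)" for t
  define d where "d t = (if conv t then (THE l. limitin mtopology (s t) l sequentially) else a 0)" for t
  have d_lim: "limitin mtopology (s t) (d t) sequentially" if "conv t" for t
  proof -
    obtain l where "limitin mtopology (s t) l sequentially" using \<open>conv t\<close> conv_def by blast
    then have "\<exists>!l. limitin mtopology (s t) l sequentially"
      using limitin_metric_unique[OF _ _ trivial_limit_sequentially] by blast
    from theI'[OF this] show ?thesis using that by (simp add: d_def)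
  qed
  have dS: "d t \<in> S" for t
    using d_lim[of t] aS by (cases "conv t") (auto simp: d_def limitin_mspace)
  \<comment> \<open>By completeness, convergence is the Cauchy property. With tolerances
    \<open>1 / Suc j\<close> this is a countable combination of measurable conditions, whereas the
    definition of \<open>conv\<close> quantifies over all limits.\<close>
  have conv_iff: "conv t \<longleftrightarrow> (\<forall>j. \<exists>N. \<forall>n\<ge>N. \<forall>m\<ge>N. r (s t n) (s t m) < 1 / Suc j)" for t
  proof -
    have "conv t \<longleftrightarrow> MCauchy (s t)"
      using mc sS convergent_imp_MCauchy unfolding mcomplete_def conv_def by blast
    also have "\<dots> \<longleftrightarrow> (\<forall>j. \<exists>N. \<forall>n\<ge>N. \<forall>m\<ge>N. r (s t n) (s t m) < 1 / Suc j)"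
    proof
      assume "MCauchy (s t)"
      then show "\<forall>j. \<exists>N. \<forall>n\<ge>N. \<forall>m\<ge>N. r (s t n) (s t m) < 1 / Suc j"
        unfolding MCauchy_def by (metis of_nat_0_less_iff zero_less_Suc zero_less_divide_1_iff)
    next
      assume *: "\<forall>j. \<exists>N. \<forall>n\<ge>N. \<forall>m\<ge>N. r (s t n) (s t m) < 1 / Suc j"
      show "MCauchy (s t)" unfolding MCauchy_def
      proof (intro conjI allI impI sS)
        fix \<epsilon> :: real assume "\<epsilon> > 0"
        then obtain j where "1 / Suc j < \<epsilon>" by (meson nat_approx_posE)
        with * show "\<exists>N. \<forall>n n'. N \<le> n \<longrightarrow> N \<le> n' \<longrightarrow> r (s t n) (s t n') < \<epsilon>"
          by (meson less_trans)
      qed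
    qed
    finally show ?thesis .
  qed
  have sm: "Measurable.pred borel (\<lambda>t. P (s t n))" for P n
    unfolding s_def by measurable
  have sm2 [measurable]: "Measurable.pred borel (\<lambda>t. r (s t n) (s t m) < c)" for n m c
    unfolding s_def by measurable
  have conv_meas [measurable]: "Measurable.pred borel conv"
    unfolding conv_iff[abs_def] by measurable
  have d_meas: "d \<in> borel \<rightarrow>\<^sub>M M"
  proof (rule measurable_sigma_sets[OF sets])
    show "{U. openin X U} \<subseteq> Pow (topspace X)" using openin_subset by auto
    show "d \<in> space borel \<rightarrow> topspace X" using dS by (simp add: Xeq)
    fix U assume "U \<in> {U. openin X U}"
    then have U: "openin mtopology U" by (simp add: Xeq)
    \<comment> \<open>Membership of the limit in an open set is expressed by countably many
      conditions on the sequence: it eventually stays in a ball around a dense point inside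
      \<open>U\<close>, with a margin \<open>1 / Suc k\<close> that keeps the limit off the
      boundary. The first disjunct is the default value \<open>a 0\<close>.\<close>
    have iff: "d t \<in> U \<longleftrightarrow> (\<not> conv t \<and> a 0 \<in> U) \<or>
        (conv t \<and> (\<exists>i j k. mball (a i) (1 / Suc j) \<subseteq> U \<and>
           (\<exists>N. \<forall>n\<ge>N. r (a i) (s t n) < 1 / Suc j - 1 / Suc k)))" for t
    proof (cases "conv t")
      case True
      let ?l = "d t"
      have lim: "\<exists>N. \<forall>n\<ge>N. r (s t n) ?l < \<epsilon>" if "\<epsilon> > 0" for \<epsilon>
        using d_lim[OF True] that unfolding limitin_metric eventually_sequentially by blast
      have sS': "s t n \<in> S" for n using sS by blast
      have "?l \<in> U \<longleftrightarrow> (\<exists>i j k. mball (a i) (1 / Suc j) \<subseteq> U \<and>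
           (\<exists>N. \<forall>n\<ge>N. r (a i) (s t n) < 1 / Suc j - 1 / Suc k))"
      proof
        assume "?l \<in> U"
        then obtain \<epsilon> where \<epsilon>: "\<epsilon> > 0" "mball ?l \<epsilon> \<subseteq> U" using U openin_mtopology by blast
        obtain j where j: "1 / Suc j < \<epsilon> / 2" using \<epsilon>(1) by (meson half_gt_zero nat_approx_posE)
        obtain k where k: "1 / Suc k < 1 / Suc j / 2"
          by (meson half_gt_zero nat_approx_posE of_nat_0_less_iff zero_less_Suc zero_less_divide_1_iff)
        \<comment> \<open>With J = \<open>1 / Suc j\<close>, two errors below J / 4 keep the tail of
          the sequence within J / 2 of \<open>a i\<close>, which leaves room for the margin
          \<open>1 / Suc k\<close> below J / 2.\<close>
        obtain i where i: "r ?l (a i) < 1 / Suc j / 4" using dense[OF dS[of t], of "1 / Suc j / 4"] by auto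
        obtain N where N: "\<forall>n\<ge>N. r (s t n) ?l < 1 / Suc j / 4"
          using lim[of "1 / Suc j / 4"] by auto
        have "mball (a i) (1 / Suc j) \<subseteq> U"
        proof
          fix y assume y: "y \<in> mball (a i) (1 / Suc j)"
          have "r ?l y \<le> r ?l (a i) + r (a i) y" using triangle[of ?l "a i" y] dS aS y by auto
          moreover have "1 / Suc j / 4 < \<epsilon> / 2" using j by (simp add: field_simps)
          ultimately have "r ?l y < \<epsilon>" using i y j by auto
          with \<epsilon>(2) y dS show "y \<in> U" by auto
        qed
        moreover have "\<forall>n\<ge>N. r (a i) (s t n) < 1 / Suc j - 1 / Suc k"
        proof (intro allI impI)
          fix n assume "n \<ge> N"
          have "r (a i) (s t n) \<le> r (a i) ?l + r ?l (s t n)"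
            using triangle[of "a i" ?l "s t n"] dS aS sS' by auto
          moreover have "u < J - \<kappa>" if "u \<le> v + w" "v < J / 4" "w < J / 4" "\<kappa> < J / 2"
            for u v w J \<kappa> :: real using that by linarith
          ultimately show "r (a i) (s t n) < 1 / Suc j - 1 / Suc k"
            using i k N[rule_format, OF \<open>n \<ge> N\<close>] by (metis commute)
        qed
        ultimately show "\<exists>i j k. mball (a i) (1 / Suc j) \<subseteq> U \<and>
           (\<exists>N. \<forall>n\<ge>N. r (a i) (s t n) < 1 / Suc j - 1 / Suc k)" by blast
      next
        assume "\<exists>i j k. mball (a i) (1 / Suc j) \<subseteq> U \<and>
           (\<exists>N. \<forall>n\<ge>N. r (a i) (s t n) < 1 / Suc j - 1 / Suc k)"
        then obtain i j k N where *: "mball (a i) (1 / Suc j) \<subseteq> U"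
          "\<forall>n\<ge>N. r (a i) (s t n) < 1 / Suc j - 1 / Suc k" by blast
        obtain N' where N': "\<forall>n\<ge>N'. r (s t n) ?l < 1 / Suc k" using lim[of "1 / Suc k"] by auto
        let ?n = "max N N'"
        have "r (a i) ?l \<le> r (a i) (s t ?n) + r (s t ?n) ?l"
          using triangle[of "a i" "s t ?n" ?l] dS aS sS' by auto
        also have "\<dots> < 1 / Suc j" using *(2)[rule_format, of ?n] N'[rule_format, of ?n] by simp
        finally show "?l \<in> U" using *(1) dS aS by auto
      qed
      then show ?thesis using True by simp
    qed (simp add: d_def)
    have [measurable]: "Measurable.pred borel (\<lambda>t. r (a i) (s t n) < c)" for i n c by (rule sm)
    have "Measurable.pred borel (\<lambda>t. d t \<in> U)" unfolding iff by measurable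
    then show "d -` U \<inter> space borel \<in> sets borel" by (simp add: pred_def vimage_def)
  qed
  have "d (e x) = x" if x: "x \<in> space M" for x
  proof -
    have "limitin mtopology (s (e x)) x sequentially"
      unfolding limitin_metric
    proof (intro conjI allI impI)
      fix \<epsilon> :: real assume "\<epsilon> > 0"
      then obtain j where j: "1 / Suc j < \<epsilon>" by (meson nat_approx_posE)
      have "r (s (e x) n) x < \<epsilon>" if "n \<ge> j" for n
      proof -
        have "r (s (e x) n) x < 1 / Suc n" using K[of x n] x by (simp add: s_def L_e S commute)
        also have "\<dots> \<le> 1 / Suc j" using that by (simp add: field_simps)
        finally show ?thesis using j by simp
      qed
      then show "\<forall>\<^sub>F n in sequentially. s (e x) n \<in> S \<and> r (s (e x) n) x < \<epsilon>"
        using sS unfolding eventually_sequentially by (intro exI[of _ j]) (auto simp: image_subset_iff)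
    qed (use x S in simp)
    moreover from this have "conv (e x)" by (auto simp: conv_def)
    ultimately show ?thesis
      using limitin_metric_unique[OF _ _ trivial_limit_sequentially] d_lim by blast
  qed
  with e_meas d_meas show thesis by (rule that)
qed

section \<open>Atomless laws on the line and the uniform law\<close>

abbreviation coin :: "bool measure" where
  "coin \<equiv> measure_pmf (pmf_of_set UNIV)"

abbreviation unif01 :: "real measure" where
  "unif01 \<equiv> restrict_space lborel {0<..<1}"

lemma emeasure_coin_singleton: "emeasure coin {b} = 1 / 2"
proof -
  have "ennreal (1 / 2) = 1 / (2::ennreal)"
    using divide_ennreal[of 1 2] by simp
  then show ?thesis by (simp add: emeasure_pmf_single UNIV_bool)
qed

text \<open>The quantile function \<open>I\<close> always pushes the uniform law to
  \<open>\<mu>\<close>. Without atoms the distribution function is continuous, hence a left inverse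
  of \<open>I\<close>.\<close>

lemma mp_iso_quantile:
  assumes "real_distribution \<mu>" and atomless: "\<And>t. measure \<mu> {t} = 0"
  obtains f g where "mp_iso unif01 \<mu> f g"
proof -
  interpret cdf_distribution \<mu> unfolding cdf_distribution_def by fact
  \<comment> \<open>The default 1/2 keeps the values in the open unit interval where the
    distribution function is 0 or 1.\<close>
  define g where "g t = (if cdf \<mu> t \<in> {0<..<1} then cdf \<mu> t else 1/2)" for t
  have f: "I \<in> unif01 \<rightarrow>\<^sub>M \<mu>"
    using measurable_CI by (simp add: measurable_def space_restrict_space sets_restrict_space)
  have g: "g \<in> \<mu> \<rightarrow>\<^sub>M unif01"
    unfolding g_def by (intro measurable_restrict_space2) (auto simp: M_is_borel)
  have cI: "cdf \<mu> (I u) = u" if u: "u \<in> {0<..<1}" for u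
  proof (rule antisym)
    \<comment> \<open>To the left of \<open>I u\<close> the distribution function is at most
      \<open>u\<close>; continuity carries this bound to the point \<open>I u\<close>
      itself.\<close>
    have "isCont (cdf \<mu>) (I u)" by (simp only: isCont_cdf atomless)
    then have "(cdf \<mu> \<longlongrightarrow> cdf \<mu> (I u)) (at_left (I u))"
      by (simp only: isCont_def filterlim_at_split)
    moreover have "cdf \<mu> x \<le> u" if "x < I u" for x
      using pseudoinverse[of u x] u that by auto
    then have "\<forall>\<^sub>F x in at_left (I u). cdf \<mu> x \<le> u"
      by (simp add: eventually_at_filter)
    ultimately show "cdf \<mu> (I u) \<le> u"
      by (rule tendsto_upperbound) simp
    show "u \<le> cdf \<mu> (I u)" using pseudoinverse[of u "I u"] u by simp
  qed
  have "mp_iso unif01 \<mu> I g"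
  proof (rule mp_isoI[OF f g])
    show "distr unif01 \<mu> I = \<mu>"
      using distr_I_eq_M by (simp cong: distr_cong)
    show "AE x in unif01. g (I x) = x"
      by (intro AE_I2) (simp add: g_def cI space_restrict_space)
    have "(\<lambda>y. I (g y)) \<in> borel_measurable \<mu>"
      using measurable_compose[OF g f] by (simp only: measurable_cong_sets[OF refl events_eq_borel])
    then show "{y \<in> space \<mu>. I (g y) = y} \<in> sets \<mu>"
      using borel_measurable_eq[of "\<lambda>y. I (g y)" \<mu> "\<lambda>y. y"] by simp
  qed
  then show thesis by (rule that)
qed

section \<open>Binary digits of a uniform number as coin tosses\<close>

definition bin_digit :: "real \<Rightarrow> nat \<Rightarrow> bool" where
  "bin_digit u n \<longleftrightarrow> odd \<lfloor>2 ^ Suc n * u\<rfloor>"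

lemma floor_double: "\<lfloor>2 * x\<rfloor> = 2 * \<lfloor>x\<rfloor> + of_bool (odd \<lfloor>2 * x::real\<rfloor>)"
proof -
  have "\<lfloor>2 * x\<rfloor> = 2 * \<lfloor>x\<rfloor> \<or> \<lfloor>2 * x\<rfloor> = 2 * \<lfloor>x\<rfloor> + 1" by linarith
  then show ?thesis by auto
qed

text \<open>The integer with binary digits \<open>w 0\<close>, ..., \<open>w (n - 1)\<close>, most
  significant first. It is the value of \<open>\<lfloor>2 ^ n * u\<rfloor>\<close> for
  \<open>u\<close> in the unit interval whose expansion starts with these digits.\<close>

fun bin_num :: "(nat \<Rightarrow> bool) \<Rightarrow> nat \<Rightarrow> int" where
  "bin_num w 0 = 0"
| "bin_num w (Suc n) = 2 * bin_num w n + of_bool (w n)"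

lemma bin_num_bounds: "0 \<le> bin_num w n" "bin_num w n + 1 \<le> 2 ^ n"
  by (induction n) (auto simp: of_bool_def)

lemma bin_digits_eq_iff:
  assumes "u \<in> {0<..<1}"
  shows "(\<forall>i<n. bin_digit u i = w i) \<longleftrightarrow> \<lfloor>2 ^ n * u\<rfloor> = bin_num w n"
proof (induction n)
  case 0
  show ?case using assms by (auto simp: floor_eq_iff)
next
  case (Suc n)
  have "\<lfloor>2 ^ Suc n * u\<rfloor> = 2 * \<lfloor>2 ^ n * u\<rfloor> + of_bool (bin_digit u n)"
    using floor_double[of "2 ^ n * u"] by (simp add: bin_digit_def mult.assoc)
  then have "\<lfloor>2 ^ Suc n * u\<rfloor> = bin_num w (Suc n) \<longleftrightarrow>
      \<lfloor>2 ^ n * u\<rfloor> = bin_num w n \<and> bin_digit u n = w n"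
    by (cases "bin_digit u n"; cases "w n"; simp; presburger)
  with Suc show ?case by (auto simp: less_Suc_eq)
qed

lemma emeasure_bin_digits:
  "emeasure unif01 {u \<in> {0<..<1}. \<forall>i<n. bin_digit u i = w i} = ennreal ((1/2) ^ n)"
proof -
  define a b :: real where "a = bin_num w n / 2 ^ n" and "b = (bin_num w n + 1) / 2 ^ n"
  have "real_of_int (bin_num w n + 1) \<le> real_of_int (2 ^ n)"
    using bin_num_bounds(2) by (simp only: of_int_le_iff)
  then have ab: "0 \<le> a" "b \<le> 1" "a \<le> b" "b - a = (1/2) ^ n"
    using bin_num_bounds(1)[of w n] by (auto simp: a_def b_def field_simps)
  have iff: "\<lfloor>2 ^ n * u\<rfloor> = bin_num w n \<longleftrightarrow> a \<le> u \<and> u < b" for u :: real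
    by (simp add: floor_eq_iff a_def b_def pos_divide_le_eq pos_less_divide_eq mult.commute)
  have "{u \<in> {0<..<1}. \<forall>i<n. bin_digit u i = w i} = {u \<in> {0<..<1}. a \<le> u \<and> u < b}"
    by (intro Collect_cong conj_cong refl) (simp only: bin_digits_eq_iff iff)
  \<comment> \<open>The dyadic interval lies in [0, 1), so 0 is the only point that it may have
    outside the open unit interval.\<close>
  also have "\<dots> = {a..<b} - {0}" using ab(1-3) by auto
  finally have eq: "{u \<in> {0<..<1}. \<forall>i<n. bin_digit u i = w i} = {a..<b} - {0}" .
  have "emeasure unif01 ({a..<b} - {0}) = emeasure lborel ({a..<b} - {0})"
    using ab by (subst emeasure_restrict_space) auto
  also have "\<dots> = emeasure lborel {a..<b}"
    by (intro emeasure_Diff_null_set) (auto simp: null_sets_def)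
  finally show ?thesis using ab eq by simp
qed

text \<open>Every cylinder over finitely many coordinates is a finite disjoint union of cylinders
  given by full prefixes of one common length, so prefixes determine the measure.\<close>

lemma coin_seq_eqI:
  assumes P: "sets P = sets (PiM UNIV (\<lambda>_::nat. coin))"
    and Q: "sets Q = sets (PiM UNIV (\<lambda>_::nat. coin))" and "finite_measure P"
    and eq: "\<And>n w. emeasure P {c. \<forall>i<n. c i = w i} = emeasure Q {c. \<forall>i<n. c i = w i}"
  shows "P = Q"
proof (rule measure_eqI_PiM_infinite[OF P Q _ \<open>finite_measure P\<close>])
  fix A J assume "finite J" "J \<subseteq> (UNIV :: nat set)"
  obtain n where n: "J \<subseteq> {..<n}" using \<open>finite J\<close> finite_nat_iff_bounded by blast
  \<comment> \<open>A prefix of length \<open>n\<close> is represented by the set of its true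
    positions; \<open>SS\<close> lists the prefixes compatible with \<open>A\<close> on
    \<open>J\<close>.\<close>
  define SS where "SS = {S \<in> Pow {..<n}. \<forall>j\<in>J. (j \<in> S) \<in> A j}"
  define cyl where "cyl S = {c. \<forall>i<n. c i \<longleftrightarrow> i \<in> S}" for S :: "nat set"
  have X: "prod_emb UNIV (\<lambda>_. coin) J (Pi\<^sub>E J A) = (\<Union>S\<in>SS. cyl S)"
  proof (intro equalityI subsetI)
    fix c assume "c \<in> prod_emb UNIV (\<lambda>_. coin) J (Pi\<^sub>E J A)"
    then show "c \<in> (\<Union>S\<in>SS. cyl S)"
      using n by (auto simp: prod_emb_def SS_def cyl_def PiE_iff subset_eq
        intro!: exI[of _ "{i\<in>{..<n}. c i}"])
  next
    fix c assume "c \<in> (\<Union>S\<in>SS. cyl S)"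
    then obtain S where S: "S \<in> SS" "c \<in> cyl S" by blast
    have "c j \<in> A j" if "j \<in> J" for j
      using S n that by (auto simp: SS_def cyl_def subset_eq)
    then show "c \<in> prod_emb UNIV (\<lambda>_. coin) J (Pi\<^sub>E J A)" by (auto simp: prod_emb_def)
  qed
  have "cyl S \<in> sets (PiM UNIV (\<lambda>_::nat. coin))" for S
  proof -
    have "{c \<in> space (PiM UNIV (\<lambda>_::nat. coin)). \<forall>i<n. c i \<longleftrightarrow> i \<in> S} \<in> sets (PiM UNIV (\<lambda>_::nat. coin))"
      by measurable
    then show ?thesis by (simp add: cyl_def space_PiM)
  qed
  moreover have "finite SS" by (simp add: SS_def)
  moreover have "disjoint_family_on cyl SS"
    unfolding disjoint_family_on_def by (auto simp: SS_def cyl_def)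
  ultimately have "emeasure R (\<Union>S\<in>SS. cyl S) = (\<Sum>S\<in>SS. emeasure R (cyl S))"
    if "sets R = sets (PiM UNIV (\<lambda>_::nat. coin))" for R
    using that by (intro sum_emeasure[symmetric]) auto
  then show "emeasure P (prod_emb UNIV (\<lambda>_. coin) J (Pi\<^sub>E J A)) = emeasure Q (prod_emb UNIV (\<lambda>_. coin) J (Pi\<^sub>E J A))"
    unfolding X using P Q eq by (simp add: cyl_def)
qed

lemma mp_iso_bin_digits:
  obtains g where "mp_iso unif01 (PiM UNIV (\<lambda>_::nat. coin)) bin_digit g"
proof -
  let ?C = "PiM UNIV (\<lambda>_::nat. coin)"
  interpret U: prob_space unif01
    by (auto simp: emeasure_restrict_space space_restrict_space intro!: prob_spaceI)
  define v where "v c = (\<Sum>n. of_bool (c n) * (1/2::real) ^ Suc n)" for c :: "nat \<Rightarrow> bool"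
  \<comment> \<open>Only the two constant sequences have \<open>v c\<close> equal to 0 or 1; they
    get the default 1/2.\<close>
  define g where "g c = (if v c \<in> {0<..<1} then v c else 1/2 :: real)" for c
  have [measurable]: "v \<in> borel_measurable ?C" unfolding v_def by measurable
  have g: "g \<in> ?C \<rightarrow>\<^sub>M unif01"
    unfolding g_def by (intro measurable_restrict_space2) auto
  have bd: "Measurable.pred borel (\<lambda>u. bin_digit u n)" for n
    unfolding bin_digit_def by measurable
  have f0: "bin_digit \<in> borel \<rightarrow>\<^sub>M ?C"
    using measurable_PiM_single'[of UNIV "\<lambda>n u. bin_digit u n" borel "\<lambda>_. coin"] bd by auto
  then have f: "bin_digit \<in> unif01 \<rightarrow>\<^sub>M ?C"
    by (intro measurable_restrict_space1) simp
  have v: "v (bin_digit u) = u" if u: "u \<in> {0<..<1}" for u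
  proof -
    \<comment> \<open>Truncating the binary series after \<open>n\<close> digits rounds
      \<open>u\<close> down to a multiple of \<open>1 / 2 ^ n\<close>, so the error is at most
      \<open>(1/2) ^ n\<close>.\<close>
    have part: "(\<Sum>i<n. of_bool (bin_digit u i) * (1/2) ^ Suc i) = \<lfloor>2 ^ n * u\<rfloor> / 2 ^ n" for n
    proof (induction n)
      case 0 then show ?case using u by (simp add: floor_eq_iff)
    next
      case (Suc n)
      have "\<lfloor>2 ^ Suc n * u\<rfloor> = 2 * \<lfloor>2 ^ n * u\<rfloor> + of_bool (bin_digit u n)"
        using floor_double[of "2 ^ n * u"] by (simp add: bin_digit_def mult.assoc)
      then have "real_of_int \<lfloor>2 ^ Suc n * u\<rfloor> = 2 * \<lfloor>2 ^ n * u\<rfloor> + of_bool (bin_digit u n)" by simp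
      with Suc show ?case by (simp add: field_simps)
    qed
    have "(\<lambda>n. \<lfloor>2 ^ n * u\<rfloor> / 2 ^ n) \<longlonglongrightarrow> u"
    proof (rule real_tendsto_sandwich)
      have "u - (1/2) ^ n \<le> \<lfloor>2 ^ n * u\<rfloor> / 2 ^ n" for n
      proof -
        have "2 ^ n * u - 1 \<le> \<lfloor>2 ^ n * u\<rfloor>" by linarith
        then have "(2 ^ n * u - 1) / 2 ^ n \<le> \<lfloor>2 ^ n * u\<rfloor> / 2 ^ n" by (rule divide_right_mono) simp
        then show ?thesis by (simp add: field_simps)
      qed
      then show "\<forall>\<^sub>F n in sequentially. u - (1/2) ^ n \<le> \<lfloor>2 ^ n * u\<rfloor> / 2 ^ n" by simp
      have "\<lfloor>2 ^ n * u\<rfloor> / 2 ^ n \<le> u" for n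
        by (simp add: field_simps)
      then show "\<forall>\<^sub>F n in sequentially. \<lfloor>2 ^ n * u\<rfloor> / 2 ^ n \<le> u" by simp
      have "(\<lambda>n. u - (1/2) ^ n) \<longlonglongrightarrow> u - 0"
        by (intro tendsto_diff tendsto_const LIMSEQ_power_zero) simp
      then show "(\<lambda>n. u - (1/2) ^ n) \<longlonglongrightarrow> u" by simp
    qed simp
    then show ?thesis
      unfolding v_def part[symmetric] by (metis sums_def sums_unique)
  qed
  have "mp_iso unif01 ?C bin_digit g"
  proof (rule mp_isoI[OF f g])
    show "AE x in unif01. g (bin_digit x) = x"
      by (intro AE_I2) (simp add: g_def v space_restrict_space)
    have "(\<lambda>c. bin_digit (g c)) \<in> ?C \<rightarrow>\<^sub>M ?C" using measurable_compose[OF g f] .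
    then have [measurable]: "Measurable.pred ?C (\<lambda>c. bin_digit (g c) n)" for n
      using measurable_compose[of _ ?C ?C "\<lambda>c. c n" "count_space UNIV"] by simp
    have "{y \<in> space ?C. \<forall>n. bin_digit (g y) n = y n} \<in> sets ?C" by measurable
    then show "{y \<in> space ?C. bin_digit (g y) = y} \<in> sets ?C" by (simp add: fun_eq_iff)
    interpret C: product_prob_space "\<lambda>_. coin" "UNIV :: nat set" by unfold_locales
    show "distr unif01 ?C bin_digit = ?C"
    proof (rule coin_seq_eqI)
      show "finite_measure (distr unif01 ?C bin_digit)"
        using f U.prob_space_distr prob_space.finite_measure by blast
      fix n w
      have *: "{c. \<forall>i<n. c i = w i} = {c \<in> space ?C. \<forall>i\<in>{..<n}. c i \<in> {w i}}"
        by (auto simp: space_PiM)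
      have "emeasure ?C {c. \<forall>i<n. c i = w i} = (\<Prod>i<n. emeasure coin {w i})"
        unfolding * by (rule C.emeasure_PiM_Collect) auto
      also have "\<dots> = (1/2) ^ n" by (simp add: emeasure_coin_singleton)
      also have "\<dots> = ennreal ((1/2) ^ n)"
        using divide_ennreal[of 1 2] by (simp flip: ennreal_power)
      also have "\<dots> = emeasure unif01 (bin_digit -` {c. \<forall>i<n. c i = w i} \<inter> space unif01)"
        by (subst emeasure_bin_digits[of n w, symmetric])
          (auto intro!: arg_cong[where f="emeasure unif01"] simp: space_restrict_space)
      also have "\<dots> = emeasure (distr unif01 ?C bin_digit) {c. \<forall>i<n. c i = w i}"
        using f by (subst emeasure_distr) (auto simp: *)
      finally show "emeasure (distr unif01 ?C bin_digit) {c. \<forall>i<n. c i = w i} = emeasure ?C {c. \<forall>i<n. c i = w i}" ..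
    qed simp_all
  qed
  then show thesis by (rule that)
qed

lemma non_atomic_singleton_null:
  assumes "non_atomic M" "A \<in> sets M" "A \<subseteq> {x}"
  shows "emeasure M A = 0"
proof (rule ccontr)
  assume "emeasure M A \<noteq> 0"
  then obtain B where "B \<in> sets M" "B \<subseteq> A" "0 < emeasure M B" "emeasure M B < emeasure M A"
    using assms(1,2) unfolding non_atomic_def by (auto simp: zero_less_iff_neq_zero)
  moreover from this have "B = {} \<or> B = A" using assms(3) by blast
  ultimately show False by auto
qed

text \<open>Three isomorphisms are composed: the real embedding onto its law \<open>\<mu>\<close>,
  the quantile map, and the binary digits. The law \<open>\<mu>\<close> has no atoms, because the
  preimage of a point under the injective \<open>e\<close> has at most one element and is
  null.\<close>

theorem non_atomic_standard_iso:
  fixes M :: "'a measure"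
  assumes "standard_prob_space M" "non_atomic M"
  obtains f g where "mp_iso M (PiM UNIV (\<lambda>_::nat. coin)) f g"
proof -
  interpret prob_space M using assms(1) by (simp add: standard_prob_space_def)
  have "standard_borel M" using assms(1) by (simp add: standard_prob_space_def)
  then obtain e :: "'a \<Rightarrow> real" and d where [measurable]: "e \<in> borel_measurable M" "d \<in> borel \<rightarrow>\<^sub>M M"
    and de: "\<And>x. x \<in> space M \<Longrightarrow> d (e x) = x"
    using standard_borel_embedding[OF _ not_empty] by metis
  define \<mu> where "\<mu> = distr M borel e"
  have "real_distribution \<mu>" unfolding \<mu>_def by (rule real_distribution_distr) simp
  have "measure \<mu> {t} = 0" for t
  proof -
    have "e -` {t} \<inter> space M \<subseteq> {d t}" using de by auto
    then have "emeasure M (e -` {t} \<inter> space M) = 0"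
      by (intro non_atomic_singleton_null[OF assms(2)]) auto
    then show ?thesis unfolding \<mu>_def by (subst measure_distr) (simp_all add: measure_def)
  qed
  then obtain f g where 2: "mp_iso unif01 \<mu> f g"
    using mp_iso_quantile[OF \<open>real_distribution \<mu>\<close>] by blast
  have 1: "mp_iso M \<mu> e d"
  proof (rule mp_isoI)
    show "distr M \<mu> e = \<mu>" unfolding \<mu>_def by (rule distr_cong) auto
    show "AE x in M. d (e x) = x" using de by simp
  qed (auto simp: \<mu>_def)
  obtain h where 3: "mp_iso unif01 (PiM UNIV (\<lambda>_::nat. coin)) bin_digit h"
    using mp_iso_bin_digits .
  show thesis
    using mp_iso_trans[OF mp_iso_trans[OF 1 mp_iso_sym[OF 2]] 3] by (rule that)
qed

section \<open>Product probability spaces and measure preserving maps\<close>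

text \<open>The sets that can be approximated by finite cylinders form a sigma-algebra containing
  the one-coordinate cylinders.\<close>

lemma (in product_prob_space) cylinder_approximation:
  assumes "W \<in> sets (PiM I M)" "\<epsilon> > 0"
  obtains J B where "finite J" "J \<subseteq> I" "B \<in> sets (PiM J M)"
    "P.prob (sym_diff W (emb I J B)) < \<epsilon>"
proof -
  define Q where "Q W \<longleftrightarrow> W \<in> sets (PiM I M) \<and> (\<forall>\<epsilon>>0. \<exists>J B. finite J \<and> J \<subseteq> I \<and> B \<in> sets (PiM J M) \<and>
    P.prob (sym_diff W (emb I J B)) < \<epsilon>)" for W
  have emb_sets [simp]: "emb I J B \<in> sets (PiM I M)" if "J \<subseteq> I" "B \<in> sets (PiM J M)" for J B
    using that by (rule measurable_prod_emb)
  have Q_Un: "Q (V \<union> W)" if "Q V" "Q W" for V W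
    unfolding Q_def
  proof (intro conjI allI impI)
    show "V \<union> W \<in> sets (PiM I M)" using that by (auto simp: Q_def)
    fix \<epsilon> :: real assume "\<epsilon> > 0"
    then have "\<epsilon> / 2 > 0" by simp
    then obtain J B where J: "finite J" "J \<subseteq> I" "B \<in> sets (PiM J M)"
        "P.prob (sym_diff V (emb I J B)) < \<epsilon> / 2"
      using \<open>Q V\<close> unfolding Q_def by blast
    obtain K C where K: "finite K" "K \<subseteq> I" "C \<in> sets (PiM K M)"
        "P.prob (sym_diff W (emb I K C)) < \<epsilon> / 2"
      using \<open>Q W\<close> \<open>\<epsilon> / 2 > 0\<close> unfolding Q_def by blast
    let ?D = "emb (J \<union> K) J B \<union> emb (J \<union> K) K C"
    have D: "?D \<in> sets (PiM (J \<union> K) M)" using J K by (intro sets.Un measurable_prod_emb) auto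
    have eq: "emb I (J \<union> K) ?D = emb I J B \<union> emb I K C"
      using J K by (simp add: prod_emb_Un prod_emb_trans)
    have sets_VW: "V \<in> sets (PiM I M)" "W \<in> sets (PiM I M)" using that by (simp_all add: Q_def)
    have "P.prob (sym_diff (V \<union> W) (emb I (J \<union> K) ?D))
        \<le> P.prob (sym_diff V (emb I J B) \<union> sym_diff W (emb I K C))"
      unfolding eq by (intro P.finite_measure_mono sets.Un sets.Diff emb_sets sets_VW J K) auto
    also have "\<dots> \<le> P.prob (sym_diff V (emb I J B)) + P.prob (sym_diff W (emb I K C))"
      by (intro measure_Un_le sets.Un sets.Diff emb_sets sets_VW J K)
    also have "\<dots> < \<epsilon>" using J(4) K(4) by simp
    finally show "\<exists>J B. finite J \<and> J \<subseteq> I \<and> B \<in> sets (PiM J M) \<and>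
        P.prob (sym_diff (V \<union> W) (emb I J B)) < \<epsilon>"
      using J K D by (intro exI[of _ "J \<union> K"] exI[of _ ?D]) auto
  qed
  have Q_empty: "Q {}"
    unfolding Q_def by (auto intro!: exI[of _ "{}"])
  have "W \<in> sigma_sets (\<Pi>\<^sub>E i\<in>I. space (M i)) {{f\<in>\<Pi>\<^sub>E i\<in>I. space (M i). f i \<in> A} | i A. i \<in> I \<and> A \<in> sets (M i)}"
    using assms(1) by (simp add: sets_PiM_single)
  then have "Q W"
  proof induction
    case (Basic a)
    then obtain i A where a: "i \<in> I" "A \<in> sets (M i)" "a = {f\<in>\<Pi>\<^sub>E i\<in>I. space (M i). f i \<in> A}" by blast
    have eq: "a = emb I {i} (\<Pi>\<^sub>E i\<in>{i}. A)"
      using a by (auto simp: prod_emb_def)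
    have "(\<Pi>\<^sub>E i\<in>{i}. A) \<in> sets (PiM {i} M)"
      using a by (intro sets_PiM_I_finite) auto
    moreover from this have "a \<in> sets (PiM I M)" unfolding eq using a by (intro emb_sets) auto
    ultimately show ?case unfolding Q_def using a(1) by (auto simp: eq intro!: exI[of _ "{i}"] exI[of _ "\<Pi>\<^sub>E i\<in>{i}. A"])
  next
    case (Compl a)
    show ?case unfolding Q_def
    proof (intro conjI allI impI)
      show "(\<Pi>\<^sub>E i\<in>I. space (M i)) - a \<in> sets (PiM I M)"
        using Compl.IH unfolding Q_def space_PiM[symmetric] by blast
      fix \<epsilon> :: real assume "\<epsilon> > 0"
      then obtain J B where J: "finite J" "J \<subseteq> I" "B \<in> sets (PiM J M)"
          "P.prob (sym_diff a (emb I J B)) < \<epsilon>"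
        using Compl.IH unfolding Q_def by blast
      let ?D = "space (PiM J M) - B"
      have "emb I J ?D = space (PiM I M) - emb I J B"
        using J(2) by (auto simp: prod_emb_def space_PiM PiE_iff subset_eq)
      then have "sym_diff ((\<Pi>\<^sub>E i\<in>I. space (M i)) - a) (emb I J ?D) = sym_diff a (emb I J B)"
        using Compl.IH sets.sets_into_space[of a "PiM I M"] by (auto simp: Q_def space_PiM prod_emb_def)
      with J show "\<exists>J B. finite J \<and> J \<subseteq> I \<and> B \<in> sets (PiM J M) \<and>
          P.prob (sym_diff ((\<Pi>\<^sub>E i\<in>I. space (M i)) - a) (emb I J B)) < \<epsilon>"
        by (intro exI[of _ J] exI[of _ ?D]) auto
    qed
  next
    case (Union a)
    have meas: "a i \<in> sets (PiM I M)" for i using Union.IH by (simp add: Q_def)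
    have fin: "Q (\<Union>i<n. a i)" for n
    proof (induction n)
      case (Suc n)
      then show ?case using Q_Un[OF Union.IH[of n] Suc] by (simp add: lessThan_Suc)
    qed (simp add: Q_empty)
    show ?case unfolding Q_def
    proof (intro conjI allI impI)
      show "(\<Union>i. a i) \<in> sets (PiM I M)" using meas by auto
      fix \<epsilon> :: real assume "\<epsilon> > 0"
      \<comment> \<open>A countable union is first replaced by a finite one, at the cost of half the
        tolerance; the other half is left for the cylinder.\<close>
      have "(\<lambda>n. P.prob (\<Union>i<n. a i)) \<longlonglongrightarrow> P.prob (\<Union>n. \<Union>i<n. a i)"
        using meas by (intro P.finite_Lim_measure_incseq) (force simp: incseq_def)+
      also have "(\<Union>n. \<Union>i<n. a i) = (\<Union>i. a i)" by auto
      finally have "\<forall>\<^sub>F n in sequentially. P.prob (\<Union>i. a i) - \<epsilon> / 2 < P.prob (\<Union>i<n. a i)"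
        using \<open>\<epsilon> > 0\<close> by (intro order_tendstoD) auto
      then obtain n where n: "P.prob (\<Union>i. a i) - \<epsilon> / 2 < P.prob (\<Union>i<n. a i)"
        by (auto simp: eventually_sequentially)
      obtain J B where J: "finite J" "J \<subseteq> I" "B \<in> sets (PiM J M)"
          "P.prob (sym_diff (\<Union>i<n. a i) (emb I J B)) < \<epsilon> / 2"
        using fin[of n] \<open>\<epsilon> > 0\<close> unfolding Q_def by (metis half_gt_zero)
      have m: "(\<Union>i. a i) \<in> sets (PiM I M)" "(\<Union>i<n. a i) \<in> sets (PiM I M)" using meas by auto
      have "P.prob (sym_diff (\<Union>i. a i) (emb I J B))
          \<le> P.prob (((\<Union>i. a i) - (\<Union>i<n. a i)) \<union> sym_diff (\<Union>i<n. a i) (emb I J B))"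
        using m J by (intro P.finite_measure_mono) auto
      also have "\<dots> \<le> P.prob ((\<Union>i. a i) - (\<Union>i<n. a i)) + P.prob (sym_diff (\<Union>i<n. a i) (emb I J B))"
        using m J by (intro measure_Un_le) auto
      also have "P.prob ((\<Union>i. a i) - (\<Union>i<n. a i)) = P.prob (\<Union>i. a i) - P.prob (\<Union>i<n. a i)"
        using m by (intro P.finite_measure_Diff) auto
      finally show "\<exists>J B. finite J \<and> J \<subseteq> I \<and> B \<in> sets (PiM J M) \<and>
          P.prob (sym_diff (\<Union>i. a i) (emb I J B)) < \<epsilon>"
        using n J by (intro exI[of _ J] exI[of _ B]) auto
    qed
  qed (rule Q_empty)
  then show thesis using \<open>\<epsilon> > 0\<close> that unfolding Q_def by blast
qed

lemma (in product_prob_space) prob_emb_Int: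
  assumes "J \<subseteq> I" "K \<subseteq> I" "J \<inter> K = {}" "B \<in> sets (PiM J M)" "C \<in> sets (PiM K M)"
  shows "P.prob (emb I J B \<inter> emb I K C) = P.prob (emb I J B) * P.prob (emb I K C)"
proof (cases "I = {}")
  case True
  then have "J = {}" "K = {}" using assms by auto
  moreover have "space (PiM I M) = {\<lambda>_. undefined}" "sets (PiM I M) = {{}, {\<lambda>_. undefined}}"
    using True by (auto simp: space_PiM sets_PiM_empty)
  ultimately show ?thesis
    using assms(4,5) P.prob_space True by (auto simp: sets_PiM_empty prod_emb_def)
next
  case False
  \<comment> \<open>The joint law of the coordinates is the product of their laws, which for a
    nonempty index set characterizes their independence. Events over disjoint index sets are then
    independent.\<close>
  have "distr (PiM I M) (PiM I M) (\<lambda>x. \<lambda>i\<in>I. x i) = PiM I M"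
  proof -
    have "distr (PiM I M) (PiM I M) (\<lambda>x. \<lambda>i\<in>I. x i) = distr (PiM I M) (PiM I M) (\<lambda>x. x)"
      by (intro distr_cong) (auto simp: space_PiM extensional_restrict PiE_def)
    then show ?thesis by (simp add: distr_id2)
  qed
  also have "\<dots> = (\<Pi>\<^sub>M i\<in>I. distr (PiM I M) (M i) (\<lambda>x. x i))"
    by (intro PiM_cong refl) (simp add: PiM_component)
  finally have ind: "P.indep_vars M (\<lambda>i x. x i) I"
    using False by (subst P.indep_vars_iff_distr_eq_PiM') auto
  show ?thesis
    using P.indep_varD[OF P.indep_var_restrict[OF ind assms(3,1,2)] assms(4,5)]
    by (simp add: prod_emb_def space_PiM vimage_def Int_def conj_commute conj_left_commute)
qed

section \<open>Constructions of measure preserving maps\<close>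

lemma mp_mapsI:
  assumes "T \<in> N \<rightarrow>\<^sub>M N" "\<And>B. B \<in> sets N \<Longrightarrow> emeasure N (T -` B \<inter> space N) = emeasure N B"
  shows "T \<in> mp_maps N"
  using assms by (auto simp: mp_maps_def intro!: measure_eqI simp: emeasure_distr)

lemma mp_mapsD:
  assumes "T \<in> mp_maps N"
  shows "T \<in> N \<rightarrow>\<^sub>M N" "B \<in> sets N \<Longrightarrow> emeasure N (T -` B \<inter> space N) = emeasure N B"
proof -
  have T: "T \<in> N \<rightarrow>\<^sub>M N" "distr N N T = N" using assms by (auto simp: mp_maps_def)
  show "T \<in> N \<rightarrow>\<^sub>M N" by fact
  assume "B \<in> sets N"
  with T(1) have "emeasure (distr N N T) B = emeasure N (T -` B \<inter> space N)" by (rule emeasure_distr)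
  then show "emeasure N (T -` B \<inter> space N) = emeasure N B" unfolding T(2) by simp
qed

text \<open>Since \<open>T\<close> preserves \<open>D\<close> and its complement, the preimage of
  \<open>B\<close> splits into the \<open>T\<close>-preimage of \<open>D \<inter> B\<close> and the
  untouched part \<open>B - D\<close>. This is what makes conditional bit flips measure
  preserving.\<close>

lemma mp_maps_piecewise:
  assumes T: "T \<in> mp_maps N" and D: "D \<in> sets N"
    and inv: "\<And>z. z \<in> space N \<Longrightarrow> T z \<in> D \<longleftrightarrow> z \<in> D"
  shows "(\<lambda>z. if z \<in> D then T z else z) \<in> mp_maps N"
proof (rule mp_mapsI)
  note [measurable] = mp_mapsD(1)[OF T] D
  show "(\<lambda>z. if z \<in> D then T z else z) \<in> N \<rightarrow>\<^sub>M N" by measurable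
  fix B assume B: "B \<in> sets N"
  have DB: "T -` (D \<inter> B) \<inter> space N \<in> sets N" using B D by (intro measurable_sets[OF mp_mapsD(1)[OF T]]) auto
  have "(\<lambda>z. if z \<in> D then T z else z) -` B \<inter> space N = (T -` (D \<inter> B) \<inter> space N) \<union> (B - D)"
    using inv sets.sets_into_space[OF B] by (auto split: if_splits)
  moreover have "(T -` (D \<inter> B) \<inter> space N) \<inter> (B - D) = {}" using inv by auto
  ultimately have "emeasure N ((\<lambda>z. if z \<in> D then T z else z) -` B \<inter> space N)
      = emeasure N (T -` (D \<inter> B) \<inter> space N) + emeasure N (B - D)"
    using DB B D by (simp add: plus_emeasure[symmetric])
  also have "\<dots> = emeasure N (D \<inter> B) + emeasure N (B - D)"
    using mp_mapsD(2)[OF T, of "D \<inter> B"] B D by simp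
  also have "\<dots> = emeasure N B"
    using B D by (subst plus_emeasure) (auto intro!: arg_cong[where f="emeasure N"])
  finally show "emeasure N ((\<lambda>z. if z \<in> D then T z else z) -` B \<inter> space N) = emeasure N B" .
qed

text \<open>Applying \<open>f\<close> in each coordinate turns a family of coin sequences into coin
  tosses indexed by pairs. Countability of \<open>I\<close> makes the almost sure identities in the
  single coordinates hold simultaneously.\<close>

lemma mp_iso_flatten:
  assumes iso: "mp_iso M (PiM UNIV (\<lambda>_::nat. coin)) f g" and "countable I"
  shows "mp_iso (PiM I (\<lambda>_. M)) (PiM (I \<times> UNIV) (\<lambda>_. coin))
    (\<lambda>x. \<lambda>p\<in>I \<times> UNIV. f (x (fst p)) (snd p)) (\<lambda>z. \<lambda>i\<in>I. g (\<lambda>n. z (i, n)))"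
    (is "mp_iso ?Y ?Z ?B ?R")
proof (rule mp_isoI)
  let ?C = "PiM UNIV (\<lambda>_::nat. coin)"
  have f: "f \<in> M \<rightarrow>\<^sub>M ?C" and g: "g \<in> ?C \<rightarrow>\<^sub>M M" and d: "distr M ?C f = ?C" "distr ?C M g = M"
    and gf: "AE x in M. g (f x) = x"
    using iso by (auto simp: mp_iso_def)
  interpret C: product_prob_space "\<lambda>_. coin" "UNIV :: nat set" by unfold_locales
  have "prob_space (distr ?C M g)" using g by (rule C.P.prob_space_distr)
  then interpret M: prob_space M unfolding d .
  interpret Y: product_prob_space "\<lambda>_. M" I by unfold_locales
  interpret Z: product_prob_space "\<lambda>_. coin" "I \<times> (UNIV :: nat set)" by unfold_locales
  have fn: "(\<lambda>x. f x n) \<in> M \<rightarrow>\<^sub>M coin" for n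
    using measurable_compose[OF f measurable_component_singleton[of n UNIV]] by simp
  show B: "?B \<in> ?Y \<rightarrow>\<^sub>M ?Z"
  proof (rule measurable_restrict)
    fix p assume "p \<in> I \<times> (UNIV :: nat set)"
    then have "(\<lambda>x. x (fst p)) \<in> ?Y \<rightarrow>\<^sub>M M" by (intro measurable_component_singleton) auto
    from measurable_compose[OF this fn] show "(\<lambda>x. f (x (fst p)) (snd p)) \<in> ?Y \<rightarrow>\<^sub>M coin" .
  qed
  show R: "?R \<in> ?Z \<rightarrow>\<^sub>M ?Y"
  proof (rule measurable_restrict)
    fix i assume "i \<in> I"
    then have "(\<lambda>z. \<lambda>n\<in>UNIV. z (i, n)) \<in> ?Z \<rightarrow>\<^sub>M ?C"
      by (intro measurable_restrict measurable_component_singleton) auto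
    from measurable_compose[OF this g] show "(\<lambda>z. g (\<lambda>n. z (i, n))) \<in> ?Z \<rightarrow>\<^sub>M M"
      by (simp add: restrict_UNIV)
  qed
  have "AE x in ?Y. \<forall>i\<in>I. g (f (x i)) = x i"
    using assms(2) by (intro AE_ball_countable[THEN iffD2] ballI Y.AE_component gf) auto
  then show "AE x in ?Y. ?R (?B x) = x"
    by (rule AE_mp) (auto intro!: AE_I2 ext simp: space_PiM PiE_def extensional_def)
  have [measurable]: "Measurable.pred ?Z (\<lambda>z. ?B (?R z) p)" if "p \<in> I \<times> UNIV" for p
    using measurable_compose[OF measurable_compose[OF R B] measurable_component_singleton[OF that]] by simp
  have "countable (I \<times> (UNIV :: nat set))" using assms(2) by auto
  then have "{z \<in> space ?Z. \<forall>p\<in>I \<times> UNIV. ?B (?R z) p = z p} \<in> sets ?Z"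
    by measurable
  also have "{z \<in> space ?Z. \<forall>p\<in>I \<times> UNIV. ?B (?R z) p = z p} = {z \<in> space ?Z. ?B (?R z) = z}"
    using measurable_space[OF measurable_compose[OF R B]]
    by (intro Collect_cong conj_cong refl iffI PiE_ext[of _ _ "\<lambda>_. UNIV"]) (auto simp: space_PiM)
  finally show "{z \<in> space ?Z. ?B (?R z) = z} \<in> sets ?Z" .
  show "distr ?Y ?Z ?B = ?Z"
  proof (rule measure_eqI_PiM_infinite[OF _ refl])
    show "finite_measure (distr ?Y ?Z ?B)"
      using Y.P.prob_space_distr[OF B] by (rule prob_space.axioms)
    fix A :: "_ \<Rightarrow> bool set" and J :: "(_ \<times> nat) set" assume J: "finite J" "J \<subseteq> I \<times> UNIV"
    \<comment> \<open>The cylinder over \<open>J\<close> is cut into rows: \<open>D i\<close>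
      collects its conditions on the bits with first index \<open>i\<close>, so both measures become
      products over rows.\<close>
    define D where "D i = {c. \<forall>n\<in>J `` {i}. c n \<in> A (i, n)}" for i
    have D_eq: "D i = {c \<in> space ?C. \<forall>n\<in>J `` {i}. c n \<in> A (i, n)}" for i
      by (simp add: D_def space_PiM)
    have fin: "finite (J `` {i})" for i using J by auto
    have D: "D i \<in> sets ?C" for i unfolding D_eq using fin by measurable
    have eD: "emeasure M (f -` D i \<inter> space M) = (\<Prod>n\<in>J `` {i}. emeasure coin (A (i, n)))" for i
    proof -
      have "emeasure M (f -` D i \<inter> space M) = emeasure (distr M ?C f) (D i)"
        using f D by (rule emeasure_distr[symmetric])
      also have "\<dots> = emeasure ?C (D i)" by (simp only: d)
      also have "\<dots> = (\<Prod>n\<in>J `` {i}. emeasure coin (A (i, n)))"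
        unfolding D_eq using fin by (intro C.emeasure_PiM_Collect) auto
      finally show ?thesis .
    qed
    let ?X = "prod_emb (I \<times> UNIV) (\<lambda>_. coin) J (Pi\<^sub>E J A)"
    have X: "?X \<in> sets ?Z" using J by (intro sets_PiM_I) auto
    have "?B -` ?X \<inter> space ?Y = {x \<in> space ?Y. \<forall>i\<in>fst ` J. x i \<in> f -` D i \<inter> space M}"
    proof (intro equalityI subsetI)
      fix x assume x: "x \<in> ?B -` ?X \<inter> space ?Y"
      then have *: "f (x i) n \<in> A (i, n)" if "(i, n) \<in> J" for i n
        using J that by (auto simp: prod_emb_def PiE_iff subset_eq dest!: bspec)
      have "x i \<in> f -` D i \<inter> space M" if "i \<in> fst ` J" for i
        using x J that * by (auto simp: D_def space_PiM PiE_iff)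
      with x show "x \<in> {x \<in> space ?Y. \<forall>i\<in>fst ` J. x i \<in> f -` D i \<inter> space M}" by simp
    next
      fix x assume x: "x \<in> {x \<in> space ?Y. \<forall>i\<in>fst ` J. x i \<in> f -` D i \<inter> space M}"
      then have "f (x (fst p)) (snd p) \<in> A p" if "p \<in> J" for p
      proof -
        have "x (fst p) \<in> f -` D (fst p)" using x that by blast
        then show ?thesis using that by (cases p) (auto simp: D_def)
      qed
      then have "?B x \<in> ?X" using J by (auto simp: prod_emb_def PiE_iff subset_eq)
      with x show "x \<in> ?B -` ?X \<inter> space ?Y" by simp
    qed
    then have "emeasure (distr ?Y ?Z ?B) ?X = emeasure ?Y {x \<in> space ?Y. \<forall>i\<in>fst ` J. x i \<in> f -` D i \<inter> space M}"
      using emeasure_distr[OF B X] by simp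
    also have "\<dots> = (\<Prod>i\<in>fst ` J. \<Prod>n\<in>J `` {i}. emeasure coin (A (i, n)))"
      unfolding eD[symmetric] using J measurable_sets[OF f D] by (intro Y.emeasure_PiM_Collect) auto
    also have "\<dots> = (\<Prod>p\<in>Sigma (fst ` J) (\<lambda>i. J `` {i}). emeasure coin (A p))"
      using J fin by (subst prod.Sigma) auto
    also have "Sigma (fst ` J) (\<lambda>i. J `` {i}) = J" by force
    also have "(\<Prod>p\<in>J. emeasure coin (A p)) = emeasure ?Z ?X"
      using J by (intro Z.emeasure_PiM_emb[symmetric]) auto
    finally show "emeasure (distr ?Y ?Z ?B) ?X = emeasure ?Z ?X" .
  qed simp
qed

lemma mp_maps_cong:
  assumes "T \<in> mp_maps N" "\<And>z. z \<in> space N \<Longrightarrow> S z = T z"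
  shows "S \<in> mp_maps N"
proof -
  have "S \<in> N \<rightarrow>\<^sub>M N" using mp_mapsD(1)[OF assms(1)] assms(2) measurable_cong[of N S T N] by simp
  moreover have "distr N N S = distr N N T" using assms(2) by (intro distr_cong) auto
  ultimately show ?thesis using assms(1) by (simp add: mp_maps_def)
qed

text \<open>An injective reindexing reads distinct, hence independent, coordinates. For translations
  by elements of the monoid, injectivity is left cancellation.\<close>

lemma mp_maps_reindex:
  assumes "prob_space M" "inj_on f I" "f \<in> I \<rightarrow> I"
  shows "(\<lambda>x. \<lambda>i\<in>I. x (f i)) \<in> mp_maps (PiM I (\<lambda>_. M))"
proof -
  have "(\<lambda>x. \<lambda>i\<in>I. x (f i)) \<in> PiM I (\<lambda>_. M) \<rightarrow>\<^sub>M PiM I (\<lambda>_. M)"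
    using assms(3) by (intro measurable_restrict measurable_component_singleton) auto
  with distr_PiM_reindex[of I "\<lambda>_. M" f I] assms show ?thesis by (simp add: mp_maps_def)
qed

lemma coin_Not: "emeasure coin (Not -` X) = emeasure coin X"
proof -
  have "map_pmf Not (pmf_of_set UNIV) = pmf_of_set (Not ` UNIV)"
    by (rule map_pmf_of_set_inj) (auto simp: inj_on_def)
  also have "Not ` UNIV = UNIV" by (auto simp: image_iff)
  finally show ?thesis by (metis emeasure_map_pmf)
qed

text \<open>A fair coin is invariant under negation; on cylinders the flip merely replaces the side
  \<open>A q\<close> by its preimage under \<open>Not\<close>.\<close>

lemma mp_maps_bit_flip:
  assumes "q \<in> I"
  shows "(\<lambda>z. z(q := \<not> z q)) \<in> mp_maps (PiM I (\<lambda>_. coin))"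
proof -
  let ?Z = "PiM I (\<lambda>_. coin)" and ?T = "\<lambda>z. z(q := \<not> z q)"
  interpret Z: product_prob_space "\<lambda>_. coin" I by unfold_locales
  have T: "?T \<in> ?Z \<rightarrow>\<^sub>M ?Z"
  proof (rule measurable_PiM_single')
    fix i assume "i \<in> I"
    have [measurable]: "Measurable.pred ?Z (\<lambda>z. z i)" if "i \<in> I" for i
      using measurable_component_singleton[OF that, of "\<lambda>_. coin"] by simp
    show "(\<lambda>z. ?T z i) \<in> ?Z \<rightarrow>\<^sub>M coin" using \<open>i \<in> I\<close> assms by (cases "i = q") simp_all
  qed (use assms in \<open>auto simp: space_PiM PiE_def extensional_def\<close>)
  have "distr ?Z ?Z ?T = ?Z"
  proof (rule measure_eqI_PiM_infinite[OF _ refl])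
    show "finite_measure (distr ?Z ?Z ?T)"
      using Z.P.prob_space_distr[OF T] by (rule prob_space.axioms)
    fix A :: "_ \<Rightarrow> bool set" and J assume J: "finite J" "J \<subseteq> I"
    let ?X = "prod_emb I (\<lambda>_. coin) J (Pi\<^sub>E J A)"
    define A' where "A' = A(q := Not -` A q)"
    have "?T -` ?X \<inter> space ?Z = prod_emb I (\<lambda>_. coin) J (Pi\<^sub>E J A')"
      using J assms by (auto simp: prod_emb_def A'_def PiE_iff space_PiM extensional_def split: if_splits)
    then have "emeasure (distr ?Z ?Z ?T) ?X = emeasure ?Z (prod_emb I (\<lambda>_. coin) J (Pi\<^sub>E J A'))"
      using J by (subst emeasure_distr[OF T]) (auto intro!: sets_PiM_I)
    also have "\<dots> = (\<Prod>i\<in>J. emeasure coin (A' i))"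
      using J by (intro Z.emeasure_PiM_emb) auto
    also have "\<dots> = (\<Prod>i\<in>J. emeasure coin (A i))"
      by (intro prod.cong refl) (simp add: A'_def coin_Not)
    also have "\<dots> = emeasure ?Z ?X"
      using J by (intro Z.emeasure_PiM_emb[symmetric]) auto
    finally show "emeasure (distr ?Z ?Z ?T) ?X = emeasure ?Z ?X" .
  qed simp
  with T show ?thesis by (simp add: mp_maps_def)
qed

section \<open>Bits indexed by a left-cancellative monoid\<close>

locale countable_left_cancellative_monoid = Group.monoid G for G (structure) +
  assumes countable_carrier: "countable (carrier G)"
    and left_cancellative: "left_cancellative G"
begin

abbreviation idx :: "('a \<times> nat) set" where
  "idx \<equiv> carrier G \<times> UNIV"

abbreviation bits :: "('a \<times> nat \<Rightarrow> bool) measure" where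
  "bits \<equiv> PiM idx (\<lambda>_. coin)"

sublocale Z: product_prob_space "\<lambda>_. coin" idx
  by unfold_locales

definition shift :: "'a \<Rightarrow> ('a \<times> nat \<Rightarrow> bool) \<Rightarrow> 'a \<times> nat \<Rightarrow> bool" where
  "shift g z = (\<lambda>p\<in>idx. z (g \<otimes> fst p, snd p))"

lemma left_cancel_iff:
  "\<lbrakk>g \<in> carrier G; h \<in> carrier G; k \<in> carrier G\<rbrakk> \<Longrightarrow> g \<otimes> h = g \<otimes> k \<longleftrightarrow> h = k"
  using left_cancellative unfolding left_cancellative_def by metis

lemma space_bits: "space bits = extensional idx"
  by (simp add: space_PiM PiE_def)

lemma bits_eqI:
  assumes "z \<in> space bits" "z' \<in> space bits" "\<And>g n. g \<in> carrier G \<Longrightarrow> z (g, n) = z' (g, n)"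
  shows "z = z'"
proof (rule extensionalityI)
  fix q assume "q \<in> idx"
  then show "z q = z' q" using assms(3)[of "fst q" "snd q"] by (simp add: mem_Times_iff)
qed (use assms(1,2) in \<open>simp_all only: space_bits\<close>)

lemma measurable_bit [measurable]: "g \<in> carrier G \<Longrightarrow> Measurable.pred bits (\<lambda>z. z (g, n))"
  using measurable_component_singleton[of "(g, n)" idx "\<lambda>_. coin"] by simp

lemma shift_mp_maps: "g \<in> carrier G \<Longrightarrow> shift g \<in> mp_maps bits"
  unfolding shift_def[abs_def]
  by (rule mp_maps_reindex[of coin "\<lambda>p. (g \<otimes> fst p, snd p)"]) (auto simp: inj_on_def left_cancel_iff measure_pmf.prob_space_axioms)

lemma shift_space: "shift g z \<in> space bits"
  by (simp add: space_bits shift_def)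

lemma shift_apply: "k \<in> carrier G \<Longrightarrow> shift g z (k, n) = z (g \<otimes> k, n)"
  by (simp add: shift_def)

lemma shift_shift:
  "\<lbrakk>g \<in> carrier G; k \<in> carrier G\<rbrakk> \<Longrightarrow> shift k (shift g z) = shift (g \<otimes> k) z"
  by (intro bits_eqI shift_space) (simp add: shift_apply m_assoc)

section \<open>Flipping the bits of one layer by a shift-invariant rule\<close>

definition layer_flip :: "'a set \<Rightarrow> nat \<Rightarrow> (('a \<times> nat \<Rightarrow> bool) \<Rightarrow> bool) \<Rightarrow> ('a \<times> nat \<Rightarrow> bool) \<Rightarrow> 'a \<times> nat \<Rightarrow> bool"
  where "layer_flip F n p z =
    (\<lambda>q\<in>idx. if fst q \<in> F \<and> snd q = n \<and> p (shift (fst q) z) then \<not> z q else z q)"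

lemma layer_flip_space: "layer_flip F n p z \<in> space bits"
  by (simp add: space_bits layer_flip_def)

lemma layer_flip_apply:
  "g \<in> carrier G \<Longrightarrow> layer_flip F n p z (g, m) =
     (if g \<in> F \<and> m = n \<and> p (shift g z) then \<not> z (g, m) else z (g, m))"
  by (simp add: layer_flip_def)

context
  fixes p :: "('a \<times> nat \<Rightarrow> bool) \<Rightarrow> bool" and n :: nat
  assumes p_meas: "Measurable.pred bits p"
    and p_layer: "\<And>z z'. \<lbrakk>z \<in> space bits; z' \<in> space bits;
        \<And>g m. \<lbrakk>g \<in> carrier G; m \<noteq> n\<rbrakk> \<Longrightarrow> z (g, m) = z' (g, m)\<rbrakk> \<Longrightarrow> p z = p z'"
begin

text \<open>The rule \<open>p\<close> ignores layer \<open>n\<close>, the only layer that changes,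
  so all decisions are the same before and after the flip. Hence flipping twice restores the
  configuration.\<close>

lemma p_shift_layer_flip:
  "g \<in> carrier G \<Longrightarrow> p (shift g (layer_flip F n p z)) = p (shift g z)"
  by (rule p_layer) (simp_all add: shift_space shift_apply layer_flip_apply)

lemma layer_flip_involution:
  assumes "z \<in> space bits"
  shows "layer_flip F n p (layer_flip F n p z) = z"
  by (rule bits_eqI) (use assms in \<open>auto simp: layer_flip_space layer_flip_apply p_shift_layer_flip\<close>)

text \<open>The decision at a site is \<open>p\<close> applied to the configuration seen from that
  site. Seen from \<open>k\<close>, the configuration shifted by \<open>g\<close> is the original
  one seen from \<open>g \<otimes> k\<close>, so the flip over the whole carrier is
  equivariant.\<close>

lemma layer_flip_shift:
  assumes "g \<in> carrier G"
  shows "layer_flip (carrier G) n p (shift g z) = shift g (layer_flip (carrier G) n p z)"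
  by (rule bits_eqI) (use assms in \<open>auto simp: layer_flip_space shift_space layer_flip_apply shift_apply shift_shift\<close>)

text \<open>Adding a site \<open>g\<close> to \<open>F\<close> composes with the flip of the single
  bit \<open>(g, n)\<close> on the event \<open>D\<close> that the rule fires at \<open>g\<close>.
  This event does not depend on layer \<open>n\<close>, so it is invariant under that flip.\<close>

lemma layer_flip_finite_mp_maps:
  assumes "finite F" "F \<subseteq> carrier G"
  shows "layer_flip F n p \<in> mp_maps bits"
  using assms
proof (induction F)
  case empty
  show ?case
    by (rule mp_maps_cong[OF mp_id], rule bits_eqI) (auto simp: layer_flip_space layer_flip_apply)
next
  case (insert g F)
  then have g: "g \<in> carrier G" and IH: "layer_flip F n p \<in> mp_maps bits" by auto
  define D where "D = {z \<in> space bits. p (shift g z)}"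
  let ?T = "\<lambda>z. z((g, n) := \<not> z (g, n))"
  have D: "D \<in> sets bits"
    unfolding D_def using measurable_compose[OF mp_mapsD(1)[OF shift_mp_maps[OF g]] p_meas] by simp
  have Tsp: "?T z \<in> space bits" if "z \<in> space bits" for z
    using that g by (auto simp: space_bits extensional_def)
  have "p (shift g (?T z)) = p (shift g z)" for z
    by (rule p_layer) (auto simp: shift_space shift_apply)
  then have "?T z \<in> D \<longleftrightarrow> z \<in> D" if "z \<in> space bits" for z
    using that Tsp[OF that] by (simp add: D_def)
  then have "(\<lambda>z. if z \<in> D then ?T z else z) \<in> mp_maps bits"
    using g D by (intro mp_maps_piecewise mp_maps_bit_flip) auto
  from mp_maps_comp[OF this IH] show ?case
  proof (rule mp_maps_cong)
    fix z assume z: "z \<in> space bits"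
    let ?y = "layer_flip F n p z"
    have D_iff: "?y \<in> D \<longleftrightarrow> p (shift g z)" using g by (simp add: D_def layer_flip_space p_shift_layer_flip)
    show "layer_flip (insert g F) n p z = (if ?y \<in> D then ?T ?y else ?y)"
    proof (cases "p (shift g z)")
      case True
      have "layer_flip (insert g F) n p z = ?T ?y"
        by (rule bits_eqI[OF layer_flip_space Tsp[OF layer_flip_space]])
          (use insert.hyps(2) g True in \<open>auto simp: layer_flip_apply\<close>)
      then show ?thesis using True D_iff by simp
    next
      case False
      have "layer_flip (insert g F) n p z = ?y"
        by (rule bits_eqI[OF layer_flip_space layer_flip_space])
          (use False in \<open>auto simp: layer_flip_apply\<close>)
      then show ?thesis using False D_iff by simp
    qed
  qed
qed

text \<open>On finitely many coordinates the flip agrees with a finite composition of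
  conditional flips of a single bit.\<close>

lemma layer_flip_mp_maps: "layer_flip (carrier G) n p \<in> mp_maps bits"
proof -
  let ?T = "layer_flip (carrier G) n p"
  have T: "?T \<in> bits \<rightarrow>\<^sub>M bits"
    unfolding layer_flip_def[abs_def]
  proof (rule measurable_restrict)
    fix q assume "q \<in> idx"
    then have q: "fst q \<in> carrier G" by (simp add: mem_Times_iff)
    have [measurable]: "Measurable.pred bits (\<lambda>z. z q)"
      using measurable_bit[OF q, of "snd q"] by simp
    have [measurable]: "Measurable.pred bits (\<lambda>z. p (shift (fst q) z))"
      using measurable_compose[OF mp_mapsD(1)[OF shift_mp_maps[OF q]] p_meas] .
    show "(\<lambda>z. if fst q \<in> carrier G \<and> snd q = n \<and> p (shift (fst q) z) then \<not> z q else z q) \<in> bits \<rightarrow>\<^sub>M coin"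
      by (cases "snd q = n") (simp_all add: q)
  qed
  have "distr bits bits ?T = bits"
  proof (rule measure_eqI_PiM_infinite[OF _ refl])
    show "finite_measure (distr bits bits ?T)"
      using Z.P.prob_space_distr[OF T] by (rule prob_space.axioms)
    fix A :: "_ \<Rightarrow> bool set" and J assume J: "finite J" "J \<subseteq> idx"
    let ?X = "prod_emb idx (\<lambda>_. coin) J (Pi\<^sub>E J A)" and ?F = "layer_flip (fst ` J) n p"
    have X: "?X \<in> sets bits" using J by (intro sets_PiM_I) auto
    have "restrict (?T z) J = restrict (?F z) J" for z
      using J(2) by (intro ext) (auto simp: restrict_def layer_flip_def image_iff intro: bexI[rotated])
    then have "?T z \<in> ?X \<longleftrightarrow> ?F z \<in> ?X" for z
      using layer_flip_space[of "carrier G" n p z] layer_flip_space[of "fst ` J" n p z]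
      by (simp add: prod_emb_def space_PiM)
    then have "?T -` ?X \<inter> space bits = ?F -` ?X \<inter> space bits" by auto
    then have "emeasure (distr bits bits ?T) ?X = emeasure bits (?F -` ?X \<inter> space bits)"
      using emeasure_distr[OF T X] by simp
    also have "\<dots> = emeasure bits ?X"
      using J X by (intro mp_mapsD(2) layer_flip_finite_mp_maps) auto
    finally show "emeasure (distr bits bits ?T) ?X = emeasure bits ?X" .
  qed simp
  with T show ?thesis by (simp add: mp_maps_def)
qed

end

section \<open>Permutations of the second index and a zero-one law\<close>

definition relabel :: "(nat \<Rightarrow> nat) \<Rightarrow> ('a \<times> nat \<Rightarrow> bool) \<Rightarrow> 'a \<times> nat \<Rightarrow> bool" where
  "relabel \<pi> z = (\<lambda>q\<in>idx. z (fst q, \<pi> (snd q)))"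

lemma relabel_mp_maps: "inj \<pi> \<Longrightarrow> relabel \<pi> \<in> mp_maps bits"
  unfolding relabel_def[abs_def]
  by (rule mp_maps_reindex[of coin "\<lambda>p. (fst p, \<pi> (snd p))"])
    (auto simp: inj_on_def measure_pmf.prob_space_axioms)

lemma relabel_space: "relabel \<pi> z \<in> space bits"
  by (simp add: space_bits relabel_def)

lemma relabel_apply: "g \<in> carrier G \<Longrightarrow> relabel \<pi> z (g, n) = z (g, \<pi> n)"
  by (simp add: relabel_def)

lemma prob_le_sym_diff:
  assumes "A \<in> sets bits" "B \<in> sets bits"
  shows "\<bar>Z.P.prob A - Z.P.prob B\<bar> \<le> Z.P.prob (sym_diff A B)"
proof -
  have "Z.P.prob A \<le> Z.P.prob (B \<union> sym_diff A B)" "Z.P.prob B \<le> Z.P.prob (A \<union> sym_diff A B)"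
    using assms by (auto intro!: Z.P.finite_measure_mono)
  moreover have "Z.P.prob (B \<union> sym_diff A B) \<le> Z.P.prob B + Z.P.prob (sym_diff A B)"
    "Z.P.prob (A \<union> sym_diff A B) \<le> Z.P.prob A + Z.P.prob (sym_diff A B)"
    using assms by (auto intro!: measure_Un_le)
  ultimately show ?thesis by linarith
qed

lemma prob_vimage: "\<lbrakk>T \<in> mp_maps bits; A \<in> sets bits\<rbrakk> \<Longrightarrow> Z.P.prob (T -` A \<inter> space bits) = Z.P.prob A"
  by (simp add: measure_def mp_mapsD(2))

text \<open>An involution that moves the layers below \<open>N\<close> off themselves, so that a
  cylinder over these layers becomes independent of its image.\<close>

definition block_swap :: "nat \<Rightarrow> nat \<Rightarrow> nat" where
  "block_swap N m = (if m < N then m + N else if m < 2 * N then m - N else m)"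

lemma block_swap_block_swap [simp]: "block_swap N (block_swap N m) = m"
  by (auto simp: block_swap_def)

lemma inj_block_swap: "inj (block_swap N)"
  by (metis injI block_swap_block_swap)

text \<open>A mixing argument: \<open>W\<close> is close to a cylinder, and a block swap turns this
  cylinder into an independent copy. As \<open>W\<close> is invariant, it is also close to the
  intersection of the two copies, so its probability equals its own square.\<close>

lemma zero_one:
  assumes W: "W \<in> sets bits"
    and inv: "\<And>N. AE z in bits. relabel (block_swap N) z \<in> W \<longleftrightarrow> z \<in> W"
  shows "Z.P.prob W = 0 \<or> Z.P.prob W = 1"
proof -
  let ?x = "Z.P.prob W"
  \<comment> \<open>One 2 \<open>\<epsilon>\<close> comes from comparing \<open>W\<close> with the
    intersection of the two cylinders, the other from comparing the squares of the probabilities of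
    the cylinder and of \<open>W\<close>.\<close>
  have small: "\<bar>?x - ?x * ?x\<bar> \<le> 4 * \<epsilon>" if "\<epsilon> > 0" for \<epsilon>
  proof -
    obtain J B where J: "finite J" "J \<subseteq> idx" "B \<in> sets (PiM J (\<lambda>_. coin))"
      and eps: "Z.P.prob (sym_diff W (prod_emb idx (\<lambda>_. coin) J B)) < \<epsilon>"
      using Z.cylinder_approximation[OF W \<open>\<epsilon> > 0\<close>] by blast
    obtain N where N: "snd ` J \<subseteq> {..<N}" using J(1) finite_nat_iff_bounded[of "snd ` J"] by auto
    let ?\<pi> = "block_swap N" and ?E = "prod_emb idx (\<lambda>_. coin) J B"
    let ?R = "relabel ?\<pi>"
    \<comment> \<open>The preimage of the cylinder under the swap is again a cylinder, over the
      swapped coordinates \<open>J'\<close>; \<open>\<rho>\<close> reads them back in the places of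
      \<open>J\<close>.\<close>
    define J' where "J' = (\<lambda>q. (fst q, ?\<pi> (snd q))) ` J"
    define \<rho> where "\<rho> y = (\<lambda>q\<in>J. y (fst q, ?\<pi> (snd q)))" for y :: "'a \<times> nat \<Rightarrow> bool"
    define B' where "B' = {y \<in> space (PiM J' (\<lambda>_. coin)). \<rho> y \<in> B}"
    have R: "?R \<in> mp_maps bits" by (intro relabel_mp_maps inj_block_swap)
    have E: "?E \<in> sets bits" using J by (intro measurable_prod_emb)
    have J': "J' \<subseteq> idx" "J \<inter> J' = {}"
      using J(2) N by (auto simp: J'_def block_swap_def subset_eq image_iff)
    have "\<rho> \<in> PiM J' (\<lambda>_. coin) \<rightarrow>\<^sub>M PiM J (\<lambda>_. coin)"
      unfolding \<rho>_def[abs_def] by (intro measurable_restrict measurable_component_singleton) (auto simp: J'_def)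
    then have B': "B' \<in> sets (PiM J' (\<lambda>_. coin))"
      unfolding B'_def using J(3) by measurable
    have RE: "?R -` ?E \<inter> space bits = prod_emb idx (\<lambda>_. coin) J' B'"
    proof -
      have "restrict (?R z) J = \<rho> (restrict z J')" for z
        using J(2) by (auto simp: fun_eq_iff \<rho>_def restrict_def relabel_def J'_def subset_eq image_iff
            intro: bexI[rotated])
      then show ?thesis
        using J'(1) relabel_space[of ?\<pi>] by (auto simp: prod_emb_def B'_def space_PiM)
    qed
    have "Z.P.prob (?E \<inter> (?R -` ?E \<inter> space bits)) = Z.P.prob ?E * Z.P.prob (?R -` ?E \<inter> space bits)"
      unfolding RE using J J' B' by (intro Z.prob_emb_Int) auto
    then have sq: "Z.P.prob (?E \<inter> (?R -` ?E \<inter> space bits)) = Z.P.prob ?E * Z.P.prob ?E"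
      by (simp add: prob_vimage[OF R E])
    note RW = measurable_sets[OF mp_mapsD(1)[OF R] W] and RE' = measurable_sets[OF mp_mapsD(1)[OF R] E]
    have V: "sym_diff W ?E \<in> sets bits" using W E by auto
    note RV = measurable_sets[OF mp_mapsD(1)[OF R] V]
    have "AE z in bits. z \<in> W \<longleftrightarrow> z \<in> W \<inter> (?R -` W \<inter> space bits)"
      using inv[of N] AE_space by eventually_elim auto
    then have 1: "?x = Z.P.prob (W \<inter> (?R -` W \<inter> space bits))"
      using W RW by (intro Z.P.finite_measure_eq_AE) auto
    have "\<bar>Z.P.prob (W \<inter> (?R -` W \<inter> space bits)) - Z.P.prob (?E \<inter> (?R -` ?E \<inter> space bits))\<bar>
        \<le> Z.P.prob (sym_diff (W \<inter> (?R -` W \<inter> space bits)) (?E \<inter> (?R -` ?E \<inter> space bits)))"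
      using W E RW RE' by (intro prob_le_sym_diff) auto
    also have "\<dots> \<le> Z.P.prob (sym_diff W ?E \<union> (?R -` (sym_diff W ?E) \<inter> space bits))"
      using V RV by (intro Z.P.finite_measure_mono) auto
    also have "\<dots> \<le> Z.P.prob (sym_diff W ?E) + Z.P.prob (?R -` (sym_diff W ?E) \<inter> space bits)"
      using V RV by (rule measure_Un_le)
    also have "\<dots> \<le> 2 * \<epsilon>" using eps unfolding prob_vimage[OF R V] by simp
    finally have 2: "\<bar>?x - Z.P.prob ?E * Z.P.prob ?E\<bar> \<le> 2 * \<epsilon>" using 1 sq by simp
    have 3: "\<bar>?x - Z.P.prob ?E\<bar> \<le> \<epsilon>" using prob_le_sym_diff[OF W E] eps by simp
    have "\<bar>Z.P.prob ?E * Z.P.prob ?E - ?x * ?x\<bar> = \<bar>Z.P.prob ?E - ?x\<bar> * \<bar>Z.P.prob ?E + ?x\<bar>"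
      unfolding abs_mult[symmetric] by (simp add: algebra_simps)
    also have "\<dots> \<le> \<epsilon> * 2"
    proof (rule mult_mono)
      show "\<bar>Z.P.prob ?E - ?x\<bar> \<le> \<epsilon>" using 3 by (simp add: abs_minus_commute)
      show "\<bar>Z.P.prob ?E + ?x\<bar> \<le> 2"
        using add_mono[OF Z.P.prob_le_1[of ?E] Z.P.prob_le_1[of W]] by simp
    qed (use \<open>\<epsilon> > 0\<close> in auto)
    finally show ?thesis using 2 by linarith
  qed
  have "\<bar>?x - ?x * ?x\<bar> \<le> 0"
  proof (rule field_le_epsilon)
    fix e :: real assume "e > 0"
    then show "\<bar>?x - ?x * ?x\<bar> \<le> 0 + e" using small[of "e / 4"] by simp
  qed
  then have "?x * (1 - ?x) = 0" by (simp add: algebra_simps)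
  then show ?thesis by auto
qed

text \<open>Agreement in one more layer halves the probability, because flipping the bit of row
  \<open>g\<close> in that layer exchanges agreement and disagreement there without affecting the
  earlier layers.\<close>

lemma AE_bits_differ:
  assumes g: "g \<in> carrier G" "g' \<in> carrier G" "g \<noteq> g'"
  shows "AE z in bits. \<exists>m\<ge>M. z (g, m) \<noteq> z (g', m)"
proof -
  define K where "K N = {z \<in> space bits. \<forall>m\<in>{M..<M+N}. z (g, m) = z (g', m)}" for N
  have K: "K N \<in> sets bits" for N unfolding K_def using g by measurable
  have half: "Z.P.prob (K N) = (1/2) ^ N" for N
  proof (induction N)
    case 0
    show ?case by (simp add: K_def Z.P.prob_space)
  next
    case (Suc N)
    let ?T = "\<lambda>z. z((g, M + N) := \<not> z (g, M + N))"
    have T: "?T \<in> mp_maps bits" using g by (intro mp_maps_bit_flip) auto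
    have sub: "K (Suc N) \<subseteq> K N" by (auto simp: K_def)
    have Tsp: "?T z \<in> space bits" if "z \<in> space bits" for z
      using that g by (auto simp: space_bits extensional_def)
    have K_Suc: "z \<in> K (Suc N) \<longleftrightarrow> z \<in> K N \<and> z (g, M + N) = z (g', M + N)" for z
      by (auto simp: K_def atLeastLessThanSuc)
    have "?T z \<in> K N \<longleftrightarrow> z \<in> K N" if "z \<in> space bits" for z
      using that Tsp[OF that] g by (auto simp: K_def)
    then have "?T z \<in> K N - K (Suc N) \<longleftrightarrow> z \<in> K (Suc N)" if "z \<in> space bits" for z
      using that g(3) by (simp add: K_Suc) blast
    moreover have "K (Suc N) \<subseteq> space bits" by (auto simp: K_def)
    ultimately have "?T -` (K N - K (Suc N)) \<inter> space bits = K (Suc N)"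
      by blast
    then have "Z.P.prob (K (Suc N)) = Z.P.prob (K N - K (Suc N))"
      using prob_vimage[OF T, of "K N - K (Suc N)"] K by auto
    also have "\<dots> = Z.P.prob (K N) - Z.P.prob (K (Suc N))"
      using K sub by (intro Z.P.finite_measure_Diff)
    finally show ?case using Suc by simp
  qed
  define L where "L = {z \<in> space bits. \<forall>m. M \<le> m \<longrightarrow> z (g, m) = z (g', m)}"
  have L: "L \<in> sets bits" unfolding L_def using g by measurable
  have "Z.P.prob L \<le> (1/2) ^ N" for N
    unfolding half[symmetric] using K by (intro Z.P.finite_measure_mono) (auto simp: K_def L_def)
  moreover have "(\<lambda>N. (1/2::real) ^ N) \<longlonglongrightarrow> 0" by (rule LIMSEQ_power_zero) simp
  ultimately have "Z.P.prob L \<le> 0" by (intro LIMSEQ_le_const) auto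
  then have "L \<in> null_sets bits" using L by (auto simp: null_sets_def Z.P.emeasure_eq_measure intro: antisym)
  from AE_not_in[OF this] show ?thesis
    by (rule AE_mp) (auto intro!: AE_I2 simp: L_def)
qed

end

section \<open>Maps commuting with the commutant of the shifts\<close>

context countable_left_cancellative_monoid
begin

text \<open>The maps \<open>T\<close> tested in \<open>commute\<close> have exact inverses and
  commute exactly with the shifts, as layer flips and block swaps do.\<close>

context
  fixes \<Delta> :: "('a \<times> nat \<Rightarrow> bool) \<Rightarrow> 'a \<times> nat \<Rightarrow> bool"
  assumes \<Delta>: "\<Delta> \<in> mp_maps bits"
    and commute: "\<And>T T'. \<lbrakk>T \<in> mp_maps bits; T' \<in> mp_maps bits;
        \<And>z. z \<in> space bits \<Longrightarrow> T' (T z) = z; \<And>z. z \<in> space bits \<Longrightarrow> T (T' z) = z;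
        \<And>g z. \<lbrakk>g \<in> carrier G; z \<in> space bits\<rbrakk> \<Longrightarrow> T (shift g z) = shift g (T z)\<rbrakk>
      \<Longrightarrow> AE z in bits. \<Delta> (T z) = T (\<Delta> z)"
begin

lemma \<Delta>_space: "z \<in> space bits \<Longrightarrow> \<Delta> z \<in> space bits"
  using measurable_space[OF mp_mapsD(1)[OF \<Delta>]] .

lemma measurable_\<Delta>_bit [measurable]: "h \<in> carrier G \<Longrightarrow> Measurable.pred bits (\<lambda>z. \<Delta> z (h, n))"
  using measurable_compose[OF mp_mapsD(1)[OF \<Delta>] measurable_bit] .

lemma commute_layer_flip:
  assumes "Measurable.pred bits p"
    and "\<And>z z'. \<lbrakk>z \<in> space bits; z' \<in> space bits;
        \<And>g m. \<lbrakk>g \<in> carrier G; m \<noteq> n\<rbrakk> \<Longrightarrow> z (g, m) = z' (g, m)\<rbrakk> \<Longrightarrow> p z = p z'"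
  shows "AE z in bits. \<Delta> (layer_flip (carrier G) n p z) = layer_flip (carrier G) n p (\<Delta> z)"
  using layer_flip_mp_maps[OF assms] layer_flip_mp_maps[OF assms]
    layer_flip_involution[OF assms] layer_flip_involution[OF assms] layer_flip_shift[OF assms]
  by (rule commute)

lemma commute_relabel: "AE z in bits. \<Delta> (relabel (block_swap N) z) = relabel (block_swap N) (\<Delta> z)"
proof -
  have mp: "relabel (block_swap N) \<in> mp_maps bits" by (intro relabel_mp_maps inj_block_swap)
  have inv: "relabel (block_swap N) (relabel (block_swap N) z) = z" if "z \<in> space bits" for z
    by (rule bits_eqI[OF relabel_space that]) (simp add: relabel_apply)
  have "relabel (block_swap N) (shift g z) = shift g (relabel (block_swap N) z)" if "g \<in> carrier G" for g z
    using that by (intro bits_eqI relabel_space shift_space) (simp add: relabel_apply shift_apply)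
  then show ?thesis using mp inv by (intro commute[OF mp mp])
qed

text \<open>If the set \<open>{\<Delta> z (h, n)}\<close> is nearly determined by the coordinates in \<open>F\<close>, flip the bits
  \<open>(g, n)\<close> of those \<open>g\<close> whose other bits match the pattern \<open>w\<close>. Where \<open>\<Delta> z\<close> has the pattern at \<open>h\<close>
  but \<open>z\<close> does not have it on \<open>F\<close>, this changes \<open>\<Delta> z (h, n)\<close> without changing \<open>z\<close> on \<open>F\<close>.
  As the sets for distinct \<open>w\<close> are disjoint, the resulting bound does not depend on \<open>N\<close>.\<close>

lemma unmatched_bound:
  assumes h: "h \<in> carrier G" and J: "finite J" "J \<subseteq> idx" "B \<in> sets (PiM J (\<lambda>_. coin))"
    and eps: "Z.P.prob (sym_diff {z \<in> space bits. \<Delta> z (h, n)} (prod_emb idx (\<lambda>_. coin) J B)) < \<epsilon>"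
  shows "Z.P.prob {z \<in> space bits. \<forall>g\<in>fst ` J. \<exists>m<N. m \<noteq> n \<and> \<Delta> z (h, m) \<noteq> z (g, m)} \<le> 2 * \<epsilon>"
proof -
  let ?F = "fst ` J" and ?W = "{z \<in> space bits. \<Delta> z (h, n)}" and ?E = "prod_emb idx (\<lambda>_. coin) J B"
  have F: "finite ?F" "?F \<subseteq> carrier G" using J by auto
  have W: "?W \<in> sets bits" using h by measurable
  have E: "?E \<in> sets bits" using J by (intro measurable_prod_emb)
  \<comment> \<open>\<open>V\<close> is the event where the cylinder predicts the bit
    \<open>\<Delta> z (h, n)\<close> wrongly.\<close>
  define V where "V = sym_diff ?W ?E"
  have V: "V \<in> sets bits" unfolding V_def using W E by auto
  \<comment> \<open>The pattern is read in the row of the unit, so that after a shift by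
    \<open>g\<close> it is read in row \<open>g\<close>. Layer \<open>n\<close> is left out, as a
    flip rule for layer \<open>n\<close> requires.\<close>
  define p where "p w z \<longleftrightarrow> (\<forall>m<N. m \<noteq> n \<longrightarrow> z (\<one>, m) = (m \<in> w))" for w :: "nat set" and z :: "'a \<times> nat \<Rightarrow> bool"
  have p_shift: "p w (shift g z) \<longleftrightarrow> (\<forall>m<N. m \<noteq> n \<longrightarrow> z (g, m) = (m \<in> w))" if "g \<in> carrier G" for w g z
    using that by (simp add: p_def shift_apply)
  define D where "D w = {z \<in> space bits. p w (shift h (\<Delta> z)) \<and> (\<forall>g\<in>?F. \<not> p w (shift g z))}" for w
  have D: "D w \<in> sets bits" for w
  proof -
    have "D w = {z \<in> space bits. (\<forall>m<N. m \<noteq> n \<longrightarrow> \<Delta> z (h, m) = (m \<in> w)) \<and>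
        (\<forall>g\<in>?F. \<not> (\<forall>m<N. m \<noteq> n \<longrightarrow> z (g, m) = (m \<in> w)))}"
      unfolding D_def using F(2) h by (intro Collect_cong) (auto simp: p_shift subset_eq)
    also have "\<dots> \<in> sets bits"
    proof -
      have [measurable]: "Measurable.pred bits (\<lambda>z. z (g, m))" if "g \<in> ?F" for g m
        using that F by auto
      show ?thesis using h F(1) by measurable
    qed
    finally show ?thesis .
  qed
  \<comment> \<open>The flip sends a point of \<open>D w - V\<close> to a point of
    \<open>D w\<close> where the prediction is unchanged but the true bit is negated, hence into
    \<open>V\<close>. As the flip preserves measure, at least half of \<open>D w\<close> lies in
    \<open>V\<close>.\<close>
  have half: "Z.P.prob (D w) \<le> 2 * Z.P.prob (D w \<inter> V)" for w
  proof -
    let ?T = "layer_flip (carrier G) n (p w)"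
    have p1: "Measurable.pred bits (p w)"
      unfolding p_def[abs_def] by measurable
    have p2: "p w z = p w z'" if "\<And>g m. \<lbrakk>g \<in> carrier G; m \<noteq> n\<rbrakk> \<Longrightarrow> z (g, m) = z' (g, m)" for z z'
      using that by (simp add: p_def)
    have T: "?T \<in> mp_maps bits" using p1 p2 by (rule layer_flip_mp_maps)
    have pT: "p w (shift g (?T z)) = p w (shift g z)" if "g \<in> carrier G" for g z
      using p1 p2 that by (rule p_shift_layer_flip)
    have "AE z in bits. \<Delta> (?T z) = ?T (\<Delta> z)" using p1 p2 by (rule commute_layer_flip)
    then have "AE z in bits. z \<in> D w - V \<longrightarrow> z \<in> ?T -` (D w \<inter> V) \<inter> space bits"
      using AE_space
    proof eventually_elim
      case (elim z)
      show ?case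
      proof
        assume z: "z \<in> D w - V"
        have "?T z \<in> D w"
          using z elim F h by (auto simp: D_def pT layer_flip_space subset_eq)
        moreover have "\<Delta> (?T z) (h, n) \<longleftrightarrow> \<not> \<Delta> z (h, n)"
          using z elim h by (simp add: D_def layer_flip_apply)
        moreover have "restrict (?T z) J = restrict z J"
        proof (intro restrict_ext)
          fix q assume "q \<in> J"
          then have "fst q \<in> carrier G" "\<not> p w (shift (fst q) z)" "q \<in> idx"
            using z F J by (auto simp: D_def)
          then show "?T z q = z q" using layer_flip_apply[of "fst q" "carrier G" n "p w" z "snd q"] by simp
        qed
        then have "?T z \<in> ?E \<longleftrightarrow> z \<in> ?E"
          using elim(2) layer_flip_space[of "carrier G" n "p w" z] by (simp add: prod_emb_def space_PiM)
        ultimately show "z \<in> ?T -` (D w \<inter> V) \<inter> space bits"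
          using z elim(2) layer_flip_space[of "carrier G" n "p w" z] by (auto simp: V_def)
      qed
    qed
    then have "Z.P.prob (D w - V) \<le> Z.P.prob (?T -` (D w \<inter> V) \<inter> space bits)"
      using D V measurable_sets[OF mp_mapsD(1)[OF T], of "D w \<inter> V"]
      by (intro Z.P.finite_measure_mono_AE) auto
    also have "\<dots> = Z.P.prob (D w \<inter> V)" using D V by (intro prob_vimage[OF T]) auto
    finally have "Z.P.prob (D w - V) \<le> Z.P.prob (D w \<inter> V)" .
    moreover have "Z.P.prob (D w) = Z.P.prob (D w - V) + Z.P.prob (D w \<inter> V)"
      using D V by (intro Z.P.finite_measure_eq_AE[THEN trans, OF _ _ _ Z.P.finite_measure_Union]) auto
    ultimately show ?thesis by simp
  qed
  define Ws where "Ws = Pow ({..<N} - {n})"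
  \<comment> \<open>A point of \<open>D w\<close> shows the pattern \<open>w\<close> in row
    \<open>h\<close> of its image under \<open>\<Delta>\<close>, which determines
    \<open>w\<close>.\<close>
  have disj: "disjoint_family_on (\<lambda>w. D w \<inter> V) Ws"
    unfolding disjoint_family_on_def
  proof (intro ballI impI equals0I)
    fix w w' z assume w: "w \<in> Ws" "w' \<in> Ws" "w \<noteq> w'" and z: "z \<in> D w \<inter> V \<inter> (D w' \<inter> V)"
    then have "m \<in> w \<longleftrightarrow> m \<in> w'" for m
      using h by (cases "m < N \<and> m \<noteq> n") (auto simp: D_def p_shift Ws_def)
    with w show False by blast
  qed
  have "{z \<in> space bits. \<forall>g\<in>?F. \<exists>m<N. m \<noteq> n \<and> \<Delta> z (h, m) \<noteq> z (g, m)} \<subseteq> (\<Union>w\<in>Ws. D w)"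
  proof
    fix z assume z: "z \<in> {z \<in> space bits. \<forall>g\<in>?F. \<exists>m<N. m \<noteq> n \<and> \<Delta> z (h, m) \<noteq> z (g, m)}"
    have "z \<in> D {m. m < N \<and> m \<noteq> n \<and> \<Delta> z (h, m)}"
    proof -
      have "\<not> p {m. m < N \<and> m \<noteq> n \<and> \<Delta> z (h, m)} (shift g z)" if "g \<in> ?F" for g
      proof -
        obtain m where "m < N" "m \<noteq> n" "\<Delta> z (h, m) \<noteq> z (g, m)" using z \<open>g \<in> ?F\<close> by blast
        then show ?thesis using p_shift[of g] F(2) \<open>g \<in> ?F\<close> by auto
      qed
      then show ?thesis using z h by (simp add: D_def p_shift)
    qed
    then show "z \<in> (\<Union>w\<in>Ws. D w)" by (auto simp: Ws_def)
  qed
  then have "Z.P.prob {z \<in> space bits. \<forall>g\<in>?F. \<exists>m<N. m \<noteq> n \<and> \<Delta> z (h, m) \<noteq> z (g, m)} \<le> Z.P.prob (\<Union>w\<in>Ws. D w)"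
    using D by (intro Z.P.finite_measure_mono) (auto simp: Ws_def)
  also have "\<dots> \<le> (\<Sum>w\<in>Ws. Z.P.prob (D w))"
    using D by (intro Z.P.finite_measure_subadditive_finite) (auto simp: Ws_def)
  also have "\<dots> \<le> (\<Sum>w\<in>Ws. 2 * Z.P.prob (D w \<inter> V))"
    by (intro sum_mono half)
  also have "\<dots> = 2 * Z.P.prob (\<Union>w\<in>Ws. D w \<inter> V)"
    using D V disj by (subst Z.P.finite_measure_finite_Union) (auto simp: Ws_def sum_distrib_left)
  also have "\<dots> \<le> 2 * Z.P.prob V"
    using V by (intro mult_left_mono Z.P.finite_measure_mono) auto
  also have "\<dots> \<le> 2 * \<epsilon>" using eps by (simp add: V_def)
  finally show ?thesis .
qed

text \<open>If no row matches, then none of the finitely many rows used by an approximating cylinder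
  matches, and the mismatches show below some \<open>N\<close>. The bound of
  \<open>unmatched_bound\<close> is uniform in \<open>N\<close>, so it survives the limit, and
  \<open>\<epsilon>\<close> is arbitrary.\<close>

lemma AE_match_off_layer:
  assumes h: "h \<in> carrier G"
  shows "AE z in bits. \<exists>g\<in>carrier G. \<forall>m. m \<noteq> n \<longrightarrow> \<Delta> z (h, m) = z (g, m)"
proof -
  define bad where "bad = {z \<in> space bits. \<forall>g\<in>carrier G. \<exists>m. m \<noteq> n \<and> \<Delta> z (h, m) \<noteq> z (g, m)}"
  have bad: "bad \<in> sets bits"
    unfolding bad_def using h countable_carrier by measurable
  have le: "Z.P.prob bad \<le> 2 * \<epsilon>" if "\<epsilon> > 0" for \<epsilon>
  proof -
    have W: "{z \<in> space bits. \<Delta> z (h, n)} \<in> sets bits" using h by measurable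
    obtain J B where J: "finite J" "J \<subseteq> idx" "B \<in> sets (PiM J (\<lambda>_. coin))"
      "Z.P.prob (sym_diff {z \<in> space bits. \<Delta> z (h, n)} (prod_emb idx (\<lambda>_. coin) J B)) < \<epsilon>"
      using Z.cylinder_approximation[OF W \<open>\<epsilon> > 0\<close>] by blast
    have F: "finite (fst ` J)" "fst ` J \<subseteq> carrier G" using J by auto
    define U where "U N = {z \<in> space bits. \<forall>g\<in>fst ` J. \<exists>m<N. m \<noteq> n \<and> \<Delta> z (h, m) \<noteq> z (g, m)}" for N
    have [measurable]: "Measurable.pred bits (\<lambda>z. z (g, m))" if "g \<in> fst ` J" for g m
      using that F by auto
    have U: "U N \<in> sets bits" for N
      unfolding U_def using h F(1) by measurable
    have "incseq U" unfolding incseq_def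
    proof (intro allI impI subsetI)
      fix M N z assume "M \<le> N" "z \<in> U M"
      then show "z \<in> U N" unfolding U_def by (blast intro: less_le_trans)
    qed
    have "bad \<subseteq> (\<Union>N. U N)"
    proof
      fix z assume z: "z \<in> bad"
      then have "\<forall>g\<in>fst ` J. \<exists>m. m \<noteq> n \<and> \<Delta> z (h, m) \<noteq> z (g, m)"
        using F(2) unfolding bad_def by blast
      then obtain m where m: "\<forall>g\<in>fst ` J. m g \<noteq> n \<and> \<Delta> z (h, m g) \<noteq> z (g, m g)" by metis
      obtain N where "m ` fst ` J \<subseteq> {..<N}" using F(1) finite_nat_iff_bounded[of "m ` fst ` J"] by auto
      then have "z \<in> U N" using m z unfolding U_def bad_def by (auto simp: image_subset_iff)
      then show "z \<in> (\<Union>N. U N)" by blast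
    qed
    then have "Z.P.prob bad \<le> Z.P.prob (\<Union>N. U N)"
      using U by (intro Z.P.finite_measure_mono) auto
    also have "\<dots> \<le> 2 * \<epsilon>"
    proof (rule LIMSEQ_le_const2)
      show "(\<lambda>N. Z.P.prob (U N)) \<longlonglongrightarrow> Z.P.prob (\<Union>N. U N)"
        using U \<open>incseq U\<close> by (intro Z.P.finite_Lim_measure_incseq) auto
      show "\<exists>N0. \<forall>N\<ge>N0. Z.P.prob (U N) \<le> 2 * \<epsilon>"
        unfolding U_def using unmatched_bound[OF h J] by blast
    qed
    finally show ?thesis .
  qed
  have "Z.P.prob bad \<le> 0"
  proof (rule field_le_epsilon)
    fix e :: real assume "e > 0"
    then show "Z.P.prob bad \<le> 0 + e" using le[of "e / 2"] by simp
  qed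
  then have "bad \<in> null_sets bits"
    using bad by (auto simp: null_sets_def Z.P.emeasure_eq_measure intro: antisym)
  from AE_not_in[OF this] show ?thesis
    by (rule AE_mp) (auto intro!: AE_I2 simp: bad_def)
qed

text \<open>A row matching off layer 0 and a row matching off layer 1 agree from layer 2 on.
  Distinct rows almost surely do not, so both are the same row, and together they cover every
  layer.\<close>

lemma AE_match:
  assumes h: "h \<in> carrier G"
  shows "AE z in bits. \<exists>g\<in>carrier G. \<forall>m. \<Delta> z (h, m) = z (g, m)"
proof -
  have "AE z in bits. \<forall>g\<in>carrier G. \<forall>g'\<in>carrier G. g \<noteq> g' \<longrightarrow> (\<exists>m\<ge>2. z (g, m) \<noteq> z (g', m))"
    using AE_bits_differ[of _ _ 2] countable_carrier
    by (intro AE_ball_countable[THEN iffD2] ballI) auto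
  with AE_match_off_layer[OF h, of 0] AE_match_off_layer[OF h, of 1] show ?thesis
  proof eventually_elim
    case (elim z)
    obtain g where g: "g \<in> carrier G" "\<And>m. m \<noteq> 0 \<Longrightarrow> \<Delta> z (h, m) = z (g, m)" using elim(1) by blast
    obtain g' where g': "g' \<in> carrier G" "\<And>m. m \<noteq> 1 \<Longrightarrow> \<Delta> z (h, m) = z (g', m)" using elim(2) by blast
    have "z (g, m) = z (g', m)" if "m \<ge> 2" for m
      using g(2)[of m] g'(2)[of m] that by simp
    then have "g = g'" using elim(3) g(1) g'(1) by blast
    then have "\<Delta> z (h, m) = z (g, m)" for m using g(2)[of m] g'(2)[of m] by (cases "m = 0") auto
    then show ?case using g(1) by blast
  qed
qed

text \<open>The event that row \<open>g\<close> is the one copied to \<open>h\<close> is invariant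
  under block swaps, because these commute with \<open>\<Delta>\<close>; so it has probability 0 or
  1. Countably many such events cover almost everything, so one has probability 1.\<close>

lemma constant_match:
  assumes h: "h \<in> carrier G"
  obtains g where "g \<in> carrier G" "AE z in bits. \<forall>m. \<Delta> z (h, m) = z (g, m)"
proof -
  define W where "W g = {z \<in> space bits. \<forall>m. \<Delta> z (h, m) = z (g, m)}" for g
  have W: "W g \<in> sets bits" if "g \<in> carrier G" for g
    unfolding W_def using that h by measurable
  have zo: "Z.P.prob (W g) = 0 \<or> Z.P.prob (W g) = 1" if g: "g \<in> carrier G" for g
  proof (rule zero_one[OF W[OF g]])
    fix N
    let ?\<pi> = "block_swap N"
    show "AE z in bits. relabel ?\<pi> z \<in> W g \<longleftrightarrow> z \<in> W g"
      using commute_relabel[of N] AE_space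
    proof eventually_elim
      case (elim z)
      have "relabel ?\<pi> z \<in> W g \<longleftrightarrow> (\<forall>m. \<Delta> z (h, ?\<pi> m) = z (g, ?\<pi> m))"
        using elim g h by (simp add: W_def relabel_space relabel_apply)
      also have "\<dots> \<longleftrightarrow> (\<forall>m. \<Delta> z (h, m) = z (g, m))" by (metis block_swap_block_swap)
      finally show ?case using elim(2) by (simp add: W_def)
    qed
  qed
  have "\<exists>g\<in>carrier G. Z.P.prob (W g) = 1"
  proof (rule ccontr)
    assume "\<not> ?thesis"
    then have "W g \<in> null_sets bits" if "g \<in> carrier G" for g
      using zo[OF that] that W[OF that] by (auto simp: null_sets_def Z.P.emeasure_eq_measure)
    then have "(\<Union>g\<in>carrier G. W g) \<in> null_sets bits"
      using countable_carrier by (intro null_sets_UN') auto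
    from AE_not_in[OF this] AE_match[OF h] AE_space have "AE z in bits. False"
      by eventually_elim (auto simp: W_def)
    then show False by simp
  qed
  then obtain g where g: "g \<in> carrier G" "Z.P.prob (W g) = 1" by blast
  then have "AE z in bits. z \<in> W g" using Z.P.AE_prob_1 by blast
  then have "AE z in bits. \<forall>m. \<Delta> z (h, m) = z (g, m)" by eventually_elim (simp add: W_def)
  with g(1) show thesis by (rule that)
qed

theorem commutant_shift:
  obtains g where "g \<in> carrier G" "AE z in bits. \<Delta> z = shift g z"
proof -
  have "\<exists>\<gamma>. \<forall>h\<in>carrier G. \<gamma> h \<in> carrier G \<and> (AE z in bits. \<forall>m. \<Delta> z (h, m) = z (\<gamma> h, m))"
    by (rule bchoice) (use constant_match in blast)
  then obtain \<gamma> where \<gamma>: "\<And>h. h \<in> carrier G \<Longrightarrow> \<gamma> h \<in> carrier G"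
    and match: "\<And>h. h \<in> carrier G \<Longrightarrow> AE z in bits. \<forall>m. \<Delta> z (h, m) = z (\<gamma> h, m)" by blast
  have \<gamma>_mult: "\<gamma> k = \<gamma> \<one> \<otimes> k" if k: "k \<in> carrier G" for k
  proof (rule ccontr)
    assume neq: "\<gamma> k \<noteq> \<gamma> \<one> \<otimes> k"
    \<comment> \<open>The flip acts on \<open>(g, 0)\<close> if the bit
      \<open>(g \<otimes> k, 1)\<close> is set. Its effect on the bit \<open>(\<one>, 0)\<close> of
      \<open>\<Delta> z\<close> is governed by \<open>\<Delta> z (k, 1)\<close>, that is by
      \<open>z (\<gamma> k, 1)\<close>, when applied after \<open>\<Delta>\<close>, and by
      \<open>z (\<gamma> \<one> \<otimes> k, 1)\<close> when applied before it.\<close>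
    define p where "p z \<longleftrightarrow> z (k, 1)" for z :: "'a \<times> nat \<Rightarrow> bool"
    let ?T = "layer_flip (carrier G) 0 p"
    have p1: "Measurable.pred bits p" unfolding p_def[abs_def] using k by measurable
    have p2: "p z = p z'" if "\<And>g m. \<lbrakk>g \<in> carrier G; m \<noteq> 0\<rbrakk> \<Longrightarrow> z (g, m) = z' (g, m)" for z z'
      using that k by (simp add: p_def)
    have T: "?T \<in> mp_maps bits" using p1 p2 by (rule layer_flip_mp_maps)
    have "AE z in bits. \<Delta> (?T z) = ?T (\<Delta> z)" using p1 p2 by (rule commute_layer_flip)
    moreover have "AE z in bits. \<Delta> (?T z) (\<one>, 0) = ?T z (\<gamma> \<one>, 0)"
      using AE_mp_maps[OF T match[OF one_closed]] by eventually_elim simp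
    ultimately have eq: "AE z in bits. z (\<gamma> \<one> \<otimes> k, 1) = z (\<gamma> k, 1)"
      using match[OF one_closed] match[OF k]
    proof eventually_elim
      case (elim z)
      have "?T (\<Delta> z) (\<one>, 0) = ?T z (\<gamma> \<one>, 0)" using elim(1,2) by simp
      then show ?case
        using elim(3,4) k \<gamma>[of \<one>] by (auto simp: layer_flip_apply p_def shift_apply split: if_splits)
    qed
    \<comment> \<open>Flipping one of two distinct bits that are almost surely equal preserves
      measure but destroys the equality.\<close>
    let ?S = "\<lambda>z. z((\<gamma> k, 1) := \<not> z (\<gamma> k, 1))"
    have "?S \<in> mp_maps bits" using \<gamma>[OF k] by (intro mp_maps_bit_flip) auto
    from AE_mp_maps[OF this eq] eq have "AE z in bits. False"
      by eventually_elim (use neq in auto)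
    then show False by simp
  qed
  have "AE z in bits. \<forall>h\<in>carrier G. \<forall>m. \<Delta> z (h, m) = z (\<gamma> h, m)"
    using countable_carrier match by (intro AE_ball_countable[THEN iffD2] ballI) auto
  then have "AE z in bits. \<Delta> z = shift (\<gamma> \<one>) z"
    using AE_space
  proof eventually_elim
    case (elim z)
    show ?case
    proof (rule bits_eqI[OF \<Delta>_space[OF elim(2)] shift_space])
      fix h m assume h: "h \<in> carrier G"
      then show "\<Delta> z (h, m) = shift (\<gamma> \<one>) z (h, m)"
        unfolding shift_apply[OF h] \<gamma>_mult[OF h, symmetric] using elim(1) by blast
    qed
  qed
  then show thesis using \<gamma>[OF one_closed] that by blast
qed

end

end

section \<open>Transport to the product space\<close>

lemma mp_iso_mp_maps_conj:
  assumes "mp_iso M N f g" "T \<in> mp_maps M"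
  shows "(\<lambda>y. f (T (g y))) \<in> mp_maps N"
proof -
  have m: "f \<in> M \<rightarrow>\<^sub>M N" "g \<in> N \<rightarrow>\<^sub>M M" "T \<in> M \<rightarrow>\<^sub>M M" "distr M N f = N" "distr N M g = M" "distr M M T = M"
    using assms by (auto simp: mp_iso_def mp_maps_def)
  have "distr N N (\<lambda>y. f (T (g y))) = distr (distr (distr N M g) M T) N f"
    using m(1-3) by (simp add: distr_distr comp_def)
  also have "\<dots> = N" by (simp only: m)
  finally show ?thesis using m by (simp add: mp_maps_def)
qed

lemma mp_class_eq_iff:
  assumes "S \<in> mp_maps N" "T \<in> mp_maps N"
  shows "mp_class N S = mp_class N T \<longleftrightarrow> (AE x in N. S x = T x)"
proof
  assume "mp_class N S = mp_class N T"
  moreover have "S \<in> mp_class N S" using assms by (simp add: mp_class_def)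
  ultimately show "AE x in N. S x = T x" by (simp add: mp_class_def)
next
  assume ST: "AE x in N. S x = T x"
  have "(AE x in N. R x = S x) \<longleftrightarrow> (AE x in N. R x = T x)" for R
  proof
    assume "AE x in N. R x = S x" with ST show "AE x in N. R x = T x" by eventually_elim simp
  next
    assume "AE x in N. R x = T x" with ST show "AE x in N. R x = S x" by eventually_elim simp
  qed
  then show "mp_class N S = mp_class N T" by (simp add: mp_class_def)
qed

lemma mem_mp_classE:
  assumes "L \<in> carrier (mp_monoid N)" "l \<in> L"
  shows "l \<in> mp_maps N" "L = mp_class N l"
proof -
  obtain T where T: "T \<in> mp_maps N" "L = mp_class N T" using assms(1) by (auto simp: mp_monoid_def)
  with assms(2) show "l \<in> mp_maps N" by (simp add: mp_class_def)
  with T assms(2) show "L = mp_class N l"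
    using mp_class_eq_iff[of l N T] by (simp add: mp_class_def)
qed

lemma mp_class_commute_iff:
  assumes "S \<in> mp_maps N" "T \<in> mp_maps N"
  shows "mp_class N S \<otimes>\<^bsub>mp_monoid N\<^esub> mp_class N T = mp_class N T \<otimes>\<^bsub>mp_monoid N\<^esub> mp_class N S
    \<longleftrightarrow> (AE x in N. S (T x) = T (S x))"
  using assms by (simp add: mp_monoid_mult_class mp_class_eq_iff mp_maps_comp)

lemma mp_class_UnitsI:
  assumes "S \<in> mp_maps N" "T \<in> mp_maps N" "AE x in N. S (T x) = x" "AE x in N. T (S x) = x"
  shows "mp_class N S \<in> Units (mp_monoid N)"
proof -
  have c: "mp_class N S \<in> carrier (mp_monoid N)" "mp_class N T \<in> carrier (mp_monoid N)"
    using assms by (auto simp: mp_monoid_def)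
  have one: "\<one>\<^bsub>mp_monoid N\<^esub> = mp_class N (\<lambda>x. x)" by (simp add: mp_monoid_def)
  have "mp_class N S \<otimes>\<^bsub>mp_monoid N\<^esub> mp_class N T = \<one>\<^bsub>mp_monoid N\<^esub>"
    "mp_class N T \<otimes>\<^bsub>mp_monoid N\<^esub> mp_class N S = \<one>\<^bsub>mp_monoid N\<^esub>"
    using assms by (simp_all add: one mp_monoid_mult_class mp_class_eq_iff mp_maps_comp mp_id)
  with c show ?thesis unfolding Units_def by blast
qed

text \<open>Closure under inverses comes from multiplying
  \<open>u \<otimes> s = s \<otimes> u\<close> by the inverse of \<open>u\<close> on both sides.
  With the classes of the shifts as \<open>S\<close>, this subgroup is the group
  \<open>\<Lambda>\<close> of the theorem.\<close>

lemma (in Group.monoid) subgroup_units_centralizer: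
  assumes "S \<subseteq> carrier G"
  shows "subgroup {u \<in> Units G. \<forall>s\<in>S. u \<otimes> s = s \<otimes> u} (units_of G)"
    (is "subgroup ?C _")
proof
  show "?C \<subseteq> carrier (units_of G)" by (auto simp: units_of_carrier)
  show "\<one>\<^bsub>units_of G\<^esub> \<in> ?C" using assms by (auto simp: units_of_one)
  fix u assume u: "u \<in> ?C"
  have "inv u \<otimes> s = s \<otimes> inv u" if "s \<in> S" for s
  proof -
    have c: "u \<in> carrier G" "inv u \<in> carrier G" "s \<in> carrier G" "u \<otimes> s = s \<otimes> u"
      using u that assms by auto
    have "inv u \<otimes> s = inv u \<otimes> (s \<otimes> (u \<otimes> inv u))" using u c by simp
    also have "\<dots> = inv u \<otimes> ((s \<otimes> u) \<otimes> inv u)" using c(1-3) by (simp add: m_assoc)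
    also have "\<dots> = inv u \<otimes> ((u \<otimes> s) \<otimes> inv u)" by (simp only: c(4))
    also have "\<dots> = (inv u \<otimes> u) \<otimes> (s \<otimes> inv u)" using c(1-3) by (simp add: m_assoc)
    also have "\<dots> = s \<otimes> inv u" using u c by simp
    finally show ?thesis .
  qed
  then show "inv\<^bsub>units_of G\<^esub> u \<in> ?C" using u by (simp add: units_of_inv)
  fix v assume v: "v \<in> ?C"
  have "u \<otimes> v \<otimes> s = s \<otimes> (u \<otimes> v)" if "s \<in> S" for s
  proof -
    have c: "u \<in> carrier G" "v \<in> carrier G" "s \<in> carrier G" "u \<otimes> s = s \<otimes> u" "v \<otimes> s = s \<otimes> v"
      using u v that assms by auto
    have "u \<otimes> v \<otimes> s = (u \<otimes> s) \<otimes> v" using c(1-3) by (simp add: m_assoc c(5))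
    then show ?thesis using c(1-3) by (simp add: m_assoc c(4))
  qed
  then show "u \<otimes>\<^bsub>units_of G\<^esub> v \<in> ?C" using u v by (simp add: units_of_mult)
qed

context countable_left_cancellative_monoid
begin

lemma shift_map_mp_maps:
  assumes "prob_space M" "g \<in> carrier G"
  shows "shift_map G g \<in> mp_maps (PiM (carrier G) (\<lambda>_. M))"
  unfolding shift_map_def[abs_def]
  by (rule mp_maps_reindex) (use assms in \<open>auto simp: inj_on_def left_cancel_iff\<close>)

lemma shift_map_shift_map:
  "\<lbrakk>g \<in> carrier G; h \<in> carrier G\<rbrakk> \<Longrightarrow> shift_map G g (shift_map G h x) = shift_map G (h \<otimes> g) x"
  by (auto simp: shift_map_def fun_eq_iff m_assoc)

context
  fixes M :: "'c measure" and f :: "'c \<Rightarrow> nat \<Rightarrow> bool" and r :: "(nat \<Rightarrow> bool) \<Rightarrow> 'c"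
  assumes iso: "mp_iso M (PiM UNIV (\<lambda>_::nat. coin)) f r"
begin

abbreviation "Y \<equiv> PiM (carrier G) (\<lambda>_. M)"

definition encode :: "('a \<Rightarrow> 'c) \<Rightarrow> 'a \<times> nat \<Rightarrow> bool" where
  "encode x = (\<lambda>p\<in>idx. f (x (fst p)) (snd p))"

definition decode :: "('a \<times> nat \<Rightarrow> bool) \<Rightarrow> 'a \<Rightarrow> 'c" where
  "decode z = (\<lambda>i\<in>carrier G. r (\<lambda>n. z (i, n)))"

lemma mp_iso_encode: "mp_iso Y bits encode decode"
  unfolding encode_def[abs_def] decode_def[abs_def]
  using mp_iso_flatten[OF iso countable_carrier] .

lemma encode_shift_map: "g \<in> carrier G \<Longrightarrow> encode (shift_map G g x) = shift g (encode x)"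
  by (auto simp: encode_def shift_map_def shift_def fun_eq_iff)

lemma decode_shift: "g \<in> carrier G \<Longrightarrow> decode (shift g z) = shift_map G g (decode z)"
  by (auto simp: decode_def shift_map_def shift_def fun_eq_iff)

lemma encode_space: "encode x \<in> space bits"
  by (simp add: encode_def space_bits)

lemma AE_encode: "AE z in bits. P z \<Longrightarrow> AE x in Y. P (encode x)"
  using mp_iso_encode AE_distr_eq[of encode Y bits P] by (simp add: mp_iso_def)

lemma AE_decode: "AE x in Y. P x \<Longrightarrow> AE z in bits. P (decode z)"
  using mp_iso_encode AE_distr_eq[of decode bits Y P] by (simp add: mp_iso_def)

lemma decode_encode: "AE x in Y. decode (encode x) = x"
  and encode_decode: "AE z in bits. encode (decode z) = z"
  using mp_iso_encode by (auto simp: mp_iso_def)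

text \<open>Conjugation by \<open>encode\<close> and \<open>decode\<close>, which intertwine the
  shifts, reduces the claim to \<open>commutant_shift\<close>. Exact identities between maps of bits
  become almost sure ones on \<open>Y\<close>, hence the form of \<open>commute\<close>.\<close>

theorem factor_shift_map:
  assumes \<Delta>: "\<Delta> \<in> mp_maps Y"
    and commute: "\<And>S S'. \<lbrakk>S \<in> mp_maps Y; S' \<in> mp_maps Y;
        AE x in Y. S' (S x) = x; AE x in Y. S (S' x) = x;
        \<And>g. g \<in> carrier G \<Longrightarrow> AE x in Y. S (shift_map G g x) = shift_map G g (S x)\<rbrakk>
      \<Longrightarrow> AE x in Y. \<Delta> (S x) = S (\<Delta> x)"
  obtains g where "g \<in> carrier G" "AE x in Y. \<Delta> x = shift_map G g x"
proof -
  define \<Delta>' where "\<Delta>' z = encode (\<Delta> (decode z))" for z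
  have \<Delta>': "\<Delta>' \<in> mp_maps bits"
    unfolding \<Delta>'_def[abs_def] by (rule mp_iso_mp_maps_conj[OF mp_iso_encode \<Delta>])
  have conj_inv: "AE x in Y. decode (T' (encode (decode (T (encode x))))) = x"
    if T: "T \<in> mp_maps bits" and inv: "\<And>z. z \<in> space bits \<Longrightarrow> T' (T z) = z" for T T'
    using decode_encode AE_encode[OF AE_mp_maps[OF T encode_decode]]
    by eventually_elim (simp add: inv encode_space)
  have "AE z in bits. \<Delta>' (T z) = T (\<Delta>' z)"
    if T: "T \<in> mp_maps bits" and T': "T' \<in> mp_maps bits"
      and inv: "\<And>z. z \<in> space bits \<Longrightarrow> T' (T z) = z" "\<And>z. z \<in> space bits \<Longrightarrow> T (T' z) = z"
      and shift: "\<And>g z. \<lbrakk>g \<in> carrier G; z \<in> space bits\<rbrakk> \<Longrightarrow> T (shift g z) = shift g (T z)"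
    for T T'
  proof -
    let ?S = "\<lambda>x. decode (T (encode x))" and ?S' = "\<lambda>x. decode (T' (encode x))"
    have "AE x in Y. \<Delta> (?S x) = ?S (\<Delta> x)"
    proof (rule commute)
      show "?S \<in> mp_maps Y" "?S' \<in> mp_maps Y"
        using T T' mp_iso_mp_maps_conj[OF mp_iso_sym[OF mp_iso_encode]] by auto
      show "AE x in Y. ?S' (?S x) = x" "AE x in Y. ?S (?S' x) = x"
        using conj_inv T T' inv by blast+
      fix g assume "g \<in> carrier G"
      then show "AE x in Y. ?S (shift_map G g x) = shift_map G g (?S x)"
        by (simp add: encode_shift_map shift encode_space decode_shift)
    qed
    \<comment> \<open>The last fact says that encoding undoes decoding at
      \<open>T (\<Delta>' z)\<close> for almost every \<open>z\<close>, since \<open>T\<close> and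
      \<open>\<Delta>'\<close> preserve null sets under preimages.\<close>
    from AE_decode[OF this] encode_decode AE_mp_maps[OF \<Delta>' AE_mp_maps[OF T encode_decode]]
    show ?thesis
    proof eventually_elim
      case (elim z)
      then have "\<Delta> (decode (T z)) = decode (T (\<Delta>' z))" by (simp add: \<Delta>'_def)
      then have "\<Delta>' (T z) = encode (decode (T (\<Delta>' z)))" by (simp add: \<Delta>'_def)
      then show ?case using elim(3) by simp
    qed
  qed
  then obtain g where g: "g \<in> carrier G" "AE z in bits. \<Delta>' z = shift g z"
    using commutant_shift[OF \<Delta>'] by blast
  have "AE x in Y. \<Delta> x = shift_map G g x"
    using AE_encode[OF g(2)] decode_encode AE_mp_maps[OF \<Delta> decode_encode]
  proof eventually_elim
    case (elim x)
    have "encode (\<Delta> x) = shift g (encode x)" using elim(1,2) by (simp add: \<Delta>'_def)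
    then have "decode (encode (\<Delta> x)) = shift_map G g (decode (encode x))"
      using g(1) by (simp add: decode_shift)
    then show ?case using elim(2,3) by simp
  qed
  with g(1) show thesis by (rule that)
qed

text \<open>Read at the unit, two shifts that agree almost surely would make rows \<open>g\<close>
  and \<open>g'\<close> of the bits coincide, which \<open>AE_bits_differ\<close> forbids.\<close>

lemma shift_map_AE_eqD:
  assumes g: "g \<in> carrier G" "g' \<in> carrier G"
    and eq: "AE x in Y. shift_map G g x = shift_map G g' x"
  shows "g = g'"
proof (rule ccontr)
  assume "g \<noteq> g'"
  from AE_decode[OF eq] AE_bits_differ[OF g this, of 0]
    AE_mp_maps[OF shift_mp_maps[OF g(1)] encode_decode]
    AE_mp_maps[OF shift_mp_maps[OF g(2)] encode_decode]
  have "AE z in bits. False"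
  proof eventually_elim
    case (elim z)
    have "encode (decode (shift g z)) = encode (decode (shift g' z))"
      using elim(1) g by (simp add: decode_shift)
    then have "shift g z = shift g' z" using elim(3,4) by simp
    then have "z (g, m) = z (g', m)" for m
      using shift_apply[OF one_closed, of g z m] shift_apply[OF one_closed, of g' z m] g by simp
    then show ?case using elim(2) by blast
  qed
  then show False by simp
qed

end

end

theorem lemma6p2:
  fixes G :: "('g, 'b) monoid_scheme"
    and Y0 :: "'a measure"
  assumes "Group.monoid G"
    and "countable (carrier G)"
    and "left_cancellative G"
    and "standard_prob_space Y0"
    and "non_atomic Y0"
  defines "Y \<equiv> PiM (carrier G) (\<lambda>_. Y0)"
  shows "\<exists>\<Lambda>. subgroup \<Lambda> (Aut_mp Y) \<and>
           (\<forall>g\<in>carrier G. shift_map G g \<in> mp_maps Y) \<and>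
           carrier (Factor \<Lambda> Y) = (\<lambda>g. mp_class Y (shift_map G g)) ` carrier G \<and>
           (\<lambda>g. mp_class Y (shift_map G g)) \<in> iso (opposite G) (Factor \<Lambda> Y)"
proof -
  interpret G: countable_left_cancellative_monoid G
    using assms(1-3) by (simp add: countable_left_cancellative_monoid_def countable_left_cancellative_monoid_axioms_def)
  obtain f r where iso: "mp_iso Y0 (PiM UNIV (\<lambda>_::nat. coin)) f r"
    using non_atomic_standard_iso[OF assms(4,5)] .
  let ?M = "mp_monoid Y" and ?s = "\<lambda>g. mp_class Y (shift_map G g)"
  interpret M: Group.monoid ?M by (rule monoid_mp_monoid)
  have sh: "shift_map G g \<in> mp_maps Y" if "g \<in> carrier G" for g
    using that assms(4) unfolding Y_def standard_prob_space_def by (intro G.shift_map_mp_maps) auto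
  then have sc: "?s ` carrier G \<subseteq> carrier ?M" by (auto simp: mp_monoid_def)
  \<comment> \<open>With the centralizer of the shifts as \<open>\<Lambda>\<close>, every shift is a
    factor map by construction; the content is that no other map commutes with
    \<open>\<Lambda>\<close>.\<close>
  define \<Lambda> where "\<Lambda> = {u \<in> Units ?M. \<forall>s\<in>?s ` carrier G. u \<otimes>\<^bsub>?M\<^esub> s = s \<otimes>\<^bsub>?M\<^esub> u}"
  have sub: "subgroup \<Lambda> (Aut_mp Y)"
    unfolding \<Lambda>_def Aut_mp_def using sc by (rule M.subgroup_units_centralizer)
  have carrier_eq: "carrier (Factor \<Lambda> Y) = ?s ` carrier G"
  proof (intro equalityI subsetI)
    fix D assume D: "D \<in> carrier (Factor \<Lambda> Y)"
    then obtain \<Delta> where \<Delta>: "\<Delta> \<in> mp_maps Y" "D = mp_class Y \<Delta>" by (auto simp: Factor_def mp_monoid_def)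
    have \<Delta>_D: "\<Delta> \<in> D" using \<Delta> by (simp add: mp_class_def)
    \<comment> \<open>The class of every almost everywhere invertible \<open>S\<close> that commutes
      with the shifts belongs to \<open>\<Lambda>\<close>, so membership in \<open>Factor\<close>
      supplies the hypothesis of \<open>factor_shift_map\<close>.\<close>
    have "AE x in Y. \<Delta> (S x) = S (\<Delta> x)"
      if S: "S \<in> mp_maps Y" "S' \<in> mp_maps Y" "AE x in Y. S' (S x) = x" "AE x in Y. S (S' x) = x"
        and com: "\<And>g. g \<in> carrier G \<Longrightarrow> AE x in Y. S (shift_map G g x) = shift_map G g (S x)" for S S'
    proof -
      have "mp_class Y S \<in> \<Lambda>"
        unfolding \<Lambda>_def using mp_class_UnitsI[OF S(1,2,4,3)] com sh S(1)
        by (auto simp: mp_class_commute_iff)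
      moreover have "S \<in> mp_class Y S" using S(1) by (simp add: mp_class_def)
      ultimately show ?thesis using D \<Delta>_D by (simp add: Factor_def)
    qed
    then obtain g where "g \<in> carrier G" "AE x in Y. \<Delta> x = shift_map G g x"
      using G.factor_shift_map[OF iso, of \<Delta>] \<Delta>(1) unfolding Y_def by blast
    then show "D \<in> ?s ` carrier G"
      unfolding \<Delta>(2) using \<Delta>(1) sh by (intro image_eqI[of _ _ g]) (simp_all add: mp_class_eq_iff)
  next
    fix D assume "D \<in> ?s ` carrier G"
    then obtain g where g: "g \<in> carrier G" "D = ?s g" by blast
    have D: "D \<in> carrier ?M" using g sc by blast
    have "AE y in Y. \<Delta> (l y) = l (\<Delta> y)" if L: "L \<in> \<Lambda>" "\<Delta> \<in> D" "l \<in> L" for L \<Delta> l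
    proof -
      have "L \<in> carrier ?M" using L(1) by (auto simp: \<Lambda>_def)
      note l = mem_mp_classE[OF this L(3)] and d = mem_mp_classE[OF D L(2)]
      have "D \<otimes>\<^bsub>?M\<^esub> L = L \<otimes>\<^bsub>?M\<^esub> D" using L(1) g by (simp add: \<Lambda>_def)
      then show ?thesis
        using mp_class_commute_iff[OF d(1) l(1)] unfolding d(2)[symmetric] l(2)[symmetric] by simp
    qed
    then show "D \<in> carrier (Factor \<Lambda> Y)" using D by (simp add: Factor_def)
  qed
  have "?s \<in> hom (opposite G) (Factor \<Lambda> Y)"
  proof (rule homI)
    fix g h assume "g \<in> carrier (opposite G)" "h \<in> carrier (opposite G)"
    then have gh: "g \<in> carrier G" "h \<in> carrier G" by (simp_all add: opposite_def)
    have "?s (g \<otimes>\<^bsub>opposite G\<^esub> h) = mp_class Y (\<lambda>x. shift_map G g (shift_map G h x))"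
      using gh by (simp add: opposite_def G.shift_map_shift_map)
    also have "\<dots> = ?s g \<otimes>\<^bsub>Factor \<Lambda> Y\<^esub> ?s h"
      using mp_monoid_mult_class[OF sh[OF gh(1)] sh[OF gh(2)]] by (simp add: Factor_def)
    finally show "?s (g \<otimes>\<^bsub>opposite G\<^esub> h) = ?s g \<otimes>\<^bsub>Factor \<Lambda> Y\<^esub> ?s h" .
  qed (use carrier_eq in \<open>auto simp: opposite_def\<close>)
  moreover have "inj_on ?s (carrier G)"
  proof (rule inj_onI)
    fix g h assume "g \<in> carrier G" "h \<in> carrier G" "?s g = ?s h"
    then show "g = h"
      using G.shift_map_AE_eqD[OF iso] sh unfolding Y_def by (simp add: mp_class_eq_iff)
  qed
  ultimately have "?s \<in> iso (opposite G) (Factor \<Lambda> Y)"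
    using carrier_eq by (simp add: iso_def bij_betw_def opposite_def)
  with sub sh carrier_eq show ?thesis by blast
qed

end
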